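(* Let $f=h+\overline g$ be a sense-preserving harmonic diffeomorphism of $\mathbb D$ onto $\mathbb D$, with $h(z)=\sum_{n\ge0}a_nz^n$ and $g(z)=\sum_{n\ge1}b_nz^n$ holomorphic in $\mathbb D$. Assume $f$ extends to an orientation-preserving homeomorphism of $\overline{\mathbb D}$ whose boundary values are odd: $f(-\zeta)=-f(\zeta)$ for $|\zeta|=1$. Then \[ |a_1|^2+|b_1|^2\ge\frac8{\pi^2}. \] The constant is sharp: the infimum of $|a_1|^2+|b_1|^2$ over all such $f$ equals $8/\pi^2$.
   Context: $\mathbb D$ is the open unit disk and $\overline{\mathbb D}$ its closure. *)

theory Defs
  imports "HOL-Complex_Analysis.Complex_Analysis"
begin

definition harm :: "(complex \<Rightarrow> complex) \<Rightarrow> (complex \<Rightarrow> complex) \<Rightarrow> complex \<Rightarrow> complex" where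
  "harm h g = (\<lambda>z. h z + cnj (g z))"

text \<open>f = h + conj g is a sense-preserving harmonic diffeomorphism of the open unit disk
  onto itself (h, g holomorphic, g(0) = 0, f bijective with positive Jacobian
  |h'|^2 - |g'|^2 > 0), and f extends to a homeomorphism of the closed disk whose
  boundary values are odd.\<close>
definition odd_admissible :: "(complex \<Rightarrow> complex) \<Rightarrow> (complex \<Rightarrow> complex) \<Rightarrow> bool" where
  "odd_admissible h g \<longleftrightarrow>
     h holomorphic_on ball 0 1 \<and> g holomorphic_on ball 0 1 \<and> g 0 = 0 \<and>
     bij_betw (harm h g) (ball 0 1) (ball 0 1) \<and>
     (\<forall>z\<in>ball 0 1. norm (deriv g z) < norm (deriv h z)) \<and>
     (\<exists>F. (\<forall>z\<in>ball 0 1. F z = harm h g z) \<and>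
          (\<exists>F'. homeomorphism (cball 0 1) (cball 0 1) F F') \<and>
          (\<forall>\<zeta>\<in>sphere 0 1. F (- \<zeta>) = - F \<zeta>))"

end

theory Submission
  imports Defs
begin

text \<open>Lower bound: write \<open>c t\<close> for the boundary curve. By Fubini, \<open>2 pi^2 (|a_1|^2 + |b_1|^2)\<close> is
  the integral of \<open>cos x\<close> against the autocorrelation of \<open>c\<close>. Oddness confines the points
  \<open>c s, c (s+x), c (s+x+y)\<close> with \<open>x + y \<le> pi\<close> to a half circle, so the angle at the middle one is
  obtuse and the mean square chord \<open>V x\<close> is superadditive. Hence \<open>K a = integral of V over [0,a]\<close>
  satisfies \<open>2 K \<le> a K'\<close>, so \<open>K a / a^2\<close> increases up to its value at \<open>pi/2\<close>, which is at most 4;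
  integrating by parts against \<open>cos\<close> gives the bound.

  Sharpness: for \<open>0 < k < 1\<close> let \<open>h\<close> map the disc conformally onto the ellipse
  \<open>|w + k cnj w| < 1\<close>, and let \<open>g = k h\<close>. As \<open>k\<close> tends to 1 the ellipse degenerates to the strip
  \<open>|Re w| < 1/2\<close>, and comparison with the strip gives \<open>|h'(0)| \<le> 4 / (pi (1 + k))\<close>. Harnack's inequality
  in supporting half planes and in interior discs of uniform radius makes \<open>h\<close> and its inverse Lipschitz,
  which yields the boundary homeomorphism without Caratheodory's theorem.\<close>

section \<open>Lower bound\<close>

lemma integral_periodic_shift:
  fixes f :: "real \<Rightarrow> 'a::euclidean_space"
  assumes f: "continuous_on UNIV f" and per: "\<And>t. f (t + 2 * pi) = f t" and x: "0 \<le> x" "x \<le> 2 * pi"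
  shows "integral {0..2*pi} (\<lambda>s. f (s + x)) = integral {0..2*pi} f"
proof -
  have int: "f integrable_on {a..b}" for a b
    by (rule integrable_continuous_real) (rule continuous_on_subset[OF f], simp)
  have "integral {0..2*pi} (\<lambda>s. f (s + x)) = integral {x..2*pi + x} f"
    using integral_shift_real_ivl[of x "x" "2*pi + x" f] by simp
  also have "\<dots> = integral {x..2*pi} f + integral {2*pi..2*pi + x} f"
    by (rule Henstock_Kurzweil_Integration.integral_combine[symmetric]) (use x int in auto)
  also have "integral {2*pi..2*pi + x} f = integral {0..x} f"
    using integral_shift_real_ivl[of "2*pi" "2*pi" "2*pi + x" f] by (simp add: per)
  also have "integral {x..2*pi} f + integral {0..x} f = integral {0..2*pi} f"
    using Henstock_Kurzweil_Integration.integral_combine[of 0 x "2*pi" f] x int by (simp add: add.commute)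
  finally show ?thesis .
qed

text \<open>After Fubini, the substitution \<open>y = x + s\<close>, free of boundary terms by
  periodicity, turns \<open>cos x\<close> into \<open>cos (y - s)\<close>, and the addition formula
  separates the variables.\<close>

lemma integral_cos_autocorrelation:
  fixes u :: "real \<Rightarrow> real"
  assumes u: "continuous_on UNIV u" and per: "\<And>t. u (t + 2 * pi) = u t"
  shows "integral {0..2*pi} (\<lambda>x. cos x * integral {0..2*pi} (\<lambda>s. u (s + x) * u s))
    = (integral {0..2*pi} (\<lambda>t. u t * cos t))\<^sup>2 + (integral {0..2*pi} (\<lambda>t. u t * sin t))\<^sup>2"
proof -
  define C where "C = integral {0..2*pi} (\<lambda>t. u t * cos t)"
  define S where "S = integral {0..2*pi} (\<lambda>t. u t * sin t)"
  have cu: "continuous_on A (\<lambda>x. u (g x))" if "continuous_on A g" for A :: "'b::topological_space set" and g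
    by (rule continuous_on_compose2[OF u that]) simp
  have iC: "(\<lambda>t. u t * cos t) integrable_on {0..2*pi}" and iS: "(\<lambda>t. u t * sin t) integrable_on {0..2*pi}"
    by (intro integrable_continuous_real continuous_intros cu)+
  have inner: "integral {0..2*pi} (\<lambda>x. cos x * (u (s + x) * u s)) = u s * cos s * C + u s * sin s * S"
    if s: "s \<in> {0..2*pi}" for s
  proof -
    have "integral {0..2*pi} (\<lambda>x. cos x * (u (s + x) * u s))
        = integral {0..2*pi} (\<lambda>x. (\<lambda>y. cos (y - s) * u y * u s) (x + s))"
      by (simp add: add.commute mult.assoc)
    also have "\<dots> = integral {0..2*pi} (\<lambda>y. cos (y - s) * u y * u s)"
    proof (rule integral_periodic_shift)
      show "continuous_on UNIV (\<lambda>y. cos (y - s) * u y * u s)" by (intro continuous_intros cu)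
      show "cos (t + 2 * pi - s) * u (t + 2 * pi) * u s = cos (t - s) * u t * u s" for t
      proof -
        have "cos (t + 2 * pi - s) = cos (t - s)" using cos_periodic[of "t - s"] by (simp add: algebra_simps)
        then show ?thesis by (simp add: per)
      qed
    qed (use s in auto)
    also have "\<dots> = integral {0..2*pi} (\<lambda>y. u s * cos s * (u y * cos y) + u s * sin s * (u y * sin y))"
      by (intro integral_cong) (simp add: cos_diff algebra_simps)
    also have "\<dots> = u s * cos s * C + u s * sin s * S"
      unfolding C_def S_def by (subst integral_add) (auto intro: integrable_on_mult_right iC iS)
    finally show ?thesis .
  qed
  have "integral {0..2*pi} (\<lambda>x. cos x * integral {0..2*pi} (\<lambda>s. u (s + x) * u s))
      = integral {0..2*pi} (\<lambda>x. integral {0..2*pi} (\<lambda>s. cos x * (u (s + x) * u s)))"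
    by simp
  also have "\<dots> = integral {0..2*pi} (\<lambda>s. integral {0..2*pi} (\<lambda>x. cos x * (u (s + x) * u s)))"
    unfolding cbox_interval[symmetric]
    by (rule integral_swap_continuous) (auto simp: split_def intro!: continuous_intros cu)
  also have "\<dots> = integral {0..2*pi} (\<lambda>s. u s * cos s * C + u s * sin s * S)"
    by (intro integral_cong inner)
  also have "\<dots> = C * C + S * S"
    unfolding C_def S_def by (subst integral_add) (auto intro: integrable_on_mult_left iC iS)
  finally show ?thesis by (simp add: C_def S_def power2_eq_square)
qed

section \<open>Odd simple closed curves on the unit circle\<close>

locale odd_circle_curve =
  fixes c :: "real \<Rightarrow> complex"
  assumes cont: "continuous_on UNIV c" and norm_c [simp]: "norm (c t) = 1"
    and anti: "c (t + pi) = - c t" and inj: "s < t \<Longrightarrow> t < s + 2 * pi \<Longrightarrow> c s \<noteq> c t"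
begin

lemma periodic: "c (t + 2 * pi) = c t"
  using anti[of "t + pi"] anti[of t] by (simp add: algebra_simps)

lemma c_nonzero: "c t \<noteq> 0"
  by (metis norm_c norm_zero zero_neq_one)

lemma continuous_c: "continuous_on A g \<Longrightarrow> continuous_on A (\<lambda>x. c (g x))"
  by (rule continuous_on_compose2[OF cont]) auto

text \<open>The arc from \<open>c s\<close> to \<open>- c s\<close> runs through a half circle in
  one direction. The middle point therefore lies between the other two, the angle there is not
  acute, and the law of cosines gives the inequality.\<close>

lemma chords_superadditive:
  assumes x: "0 \<le> x" and y: "0 \<le> y" and xy: "x + y \<le> pi"
  shows "(norm (c (s + x) - c s))\<^sup>2 + (norm (c (s + x + y) - c (s + x)))\<^sup>2 \<le> (norm (c (s + x + y) - c s))\<^sup>2"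
proof -
  \<comment> \<open>Rotating \<open>c s\<close> to 1 makes the arc over \<open>[0, pi]\<close> run
    from 1 to -1, the end point by \<open>anti\<close>.\<close>
  define d where "d t = c (s + t) * cnj (c s)" for t
  have cs: "c s * cnj (c s) = 1" using norm_c[of s] by (simp add: complex_norm_square[symmetric])
  have d0: "d 0 = 1" using cs by (simp add: d_def)
  have dpi: "d pi = -1" using cs by (simp add: d_def anti)
  have nd: "norm (d t) = 1" for t by (simp add: d_def norm_mult)
  have circ: "(Re (d t))\<^sup>2 + (Im (d t))\<^sup>2 = 1" for t using nd[of t] by (simp flip: cmod_power2)
  have Re_bd: "- 1 \<le> Re (d t)" "Re (d t) \<le> 1" for t
    using abs_Re_le_cmod[of "d t"] nd[of t] by auto
  have d_inj: "d t \<noteq> d t'" if "0 \<le> t" "t < t'" "t' \<le> pi" for t t'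
  proof -
    have "c (s + t) \<noteq> c (s + t')" using that by (intro inj) auto
    moreover have "cnj (c s) \<noteq> 0" by (simp add: c_nonzero)
    ultimately show ?thesis by (simp add: d_def)
  qed
  have cd: "continuous_on A d" for A unfolding d_def by (intro continuous_intros continuous_c)
  \<comment> \<open>On the circle only 1 and -1 are real, and injectivity reserves them for the
    parameters 0 and \<open>pi\<close>.\<close>
  have Im_nz: "Im (d t) \<noteq> 0" if "0 < t" "t < pi" for t
  proof
    assume "Im (d t) = 0"
    moreover from this have "(Re (d t))\<^sup>2 = 1\<^sup>2" using circ[of t] by simp
    then have "Re (d t) = 1 \<or> Re (d t) = -1" unfolding power2_eq_iff by simp
    ultimately have "d t = d 0 \<or> d t = d pi" by (auto simp: d0 dpi complex_eq_iff)
    then show False using d_inj[of 0 t] d_inj[of t pi] that by auto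
  qed
  \<comment> \<open>A change of sign would force a zero by the intermediate value theorem, so the
    interior of the arc stays in one open half plane.\<close>
  have Im_sign: "Im (d t) * Im (d t') > 0" if t: "0 < t" "t \<le> t'" "t' < pi" for t t'
  proof (rule ccontr)
    assume "\<not> ?thesis"
    then have "Im (d t) \<le> 0 \<and> 0 \<le> Im (d t') \<or> Im (d t') \<le> 0 \<and> 0 \<le> Im (d t)"
      by (auto simp: not_less mult_le_0_iff)
    moreover have "continuous_on {t..t'} (\<lambda>t. Im (d t))" by (intro continuous_intros cd)
    ultimately obtain w where "t \<le> w" "w \<le> t'" "Im (d w) = 0"
      using IVT'[of "\<lambda>t. Im (d t)" t 0 t'] IVT2'[of "\<lambda>t. Im (d t)" t' 0 t] t(2) by blast
    then show False using Im_nz[of w] t by auto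
  qed
  \<comment> \<open>On a half circle the real part is an injective coordinate, so along the arc it
    is continuous and injective, hence monotone. Starting from its maximal value 1 it can only
    decrease.\<close>
  have Re_anti: "Re (d t') \<le> Re (d t)" if t: "0 \<le> t" "t \<le> t'" "t' \<le> pi" for t t'
  proof (cases "t = 0 \<or> t = t' \<or> t' = pi")
    case True
    then show ?thesis using d0 dpi Re_bd[of t] Re_bd[of t'] by auto
  next
    case False
    then have t: "0 < t" "t < t'" "t' < pi" using t by auto
    have "inj_on (\<lambda>t. Re (d t)) {0..t'}"
    proof (rule linorder_inj_onI)
      fix a b assume ab: "a < b" "a \<in> {0..t'}" "b \<in> {0..t'}"
      show "Re (d a) \<noteq> Re (d b)"
      proof
        assume eq: "Re (d a) = Re (d b)"
        then have "(Im (d a))\<^sup>2 = (Im (d b))\<^sup>2" using circ[of a] circ[of b] by simp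
        then have "Im (d a) = Im (d b) \<or> Im (d a) = - Im (d b)" by (simp add: power2_eq_iff)
        moreover have "Im (d a) \<noteq> - Im (d b)" if "a \<noteq> 0"
          using Im_sign[of a b] ab t that by (auto simp: not_less[symmetric])
        moreover have "Im (d b) = 0" if "a = 0" using that eq circ[of b] by (simp add: d0)
        ultimately have "Im (d a) = Im (d b)" using d0 by fastforce
        then show False using eq d_inj[of a b] ab t by (auto simp: complex_eq_iff)
      qed
    qed auto
    moreover have "continuous_on {0..t'} (\<lambda>t. Re (d t))" by (intro continuous_intros cd)
    ultimately show ?thesis
      using continuous_inj_imp_mono[of 0 t t' "\<lambda>t. Re (d t)"] t Re_bd(2)[of t] by (auto simp: d0)
  qed
  define r1 i1 r2 i2 where "r1 = Re (d x)" "i1 = Im (d x)" "r2 = Re (d (x + y))" "i2 = Im (d (x + y))"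
  note D = this
  have r: "r2 \<le> r1" "-1 \<le> r2" "r1 \<le> 1" using Re_anti[of x "x + y"] Re_bd x y xy by (auto simp: D)
  have sq: "i1\<^sup>2 = 1 - r1\<^sup>2" "i2\<^sup>2 = 1 - r2\<^sup>2" using circ[of x] circ[of "x + y"] by (auto simp: D)
  have i: "0 \<le> i1 * i2"
  proof (cases "x = 0 \<or> x + y = pi")
    case True
    then show ?thesis using d0 dpi by (auto simp: D)
  next
    case False
    then show ?thesis using Im_sign[of x "x + y"] x y xy by (auto simp: D intro: less_imp_le)
  qed
  \<comment> \<open>Expanding the three squared chords shows that the goal is equivalent to this
    inequality. Its right side is nonnegative, so it may be squared; \<open>circ\<close> then
    reduces it to \<open>r2 \<le> r1\<close>.\<close>
  have key: "(1 + r2) * (1 - r1) \<le> i1 * i2"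
  proof (rule power2_le_imp_le[OF _ i])
    have "(i1 * i2)\<^sup>2 - ((1 + r2) * (1 - r1))\<^sup>2 = 2 * ((1 + r2) * (1 - r1) * (r1 - r2))"
      unfolding power_mult_distrib sq by (simp add: power2_eq_square algebra_simps)
    also have "\<dots> \<ge> 0" using r by (intro mult_nonneg_nonneg) auto
    finally show "((1 + r2) * (1 - r1))\<^sup>2 \<le> (i1 * i2)\<^sup>2" by simp
  qed
  have chord: "norm (c (s + a) - c (s + b)) = norm (d a - d b)" for a b
    by (simp add: d_def norm_mult flip: left_diff_distrib)
  have "(norm (d x - d 0))\<^sup>2 + (norm (d (x + y) - d x))\<^sup>2 \<le> (norm (d (x + y) - d 0))\<^sup>2"
  proof -
    have "(norm (d x - d 0))\<^sup>2 = 2 - 2 * r1"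
      using circ[of x] unfolding cmod_power2 by (simp add: D d0 power2_eq_square algebra_simps)
    moreover have "(norm (d (x + y) - d 0))\<^sup>2 = 2 - 2 * r2"
      using circ[of "x + y"] unfolding cmod_power2 by (simp add: D d0 power2_eq_square algebra_simps)
    moreover have "(norm (d (x + y) - d x))\<^sup>2 = 2 - 2 * (r1 * r2 + i1 * i2)"
      using circ[of x] circ[of "x + y"] unfolding cmod_power2 by (simp add: D power2_eq_square algebra_simps)
    ultimately show ?thesis using key by (simp add: algebra_simps)
  qed
  then show ?thesis using chord[of x 0] chord[of "x + y" x] chord[of "x + y" 0] by (simp add: add.assoc)
qed

section \<open>Integrated squared chords and the autocorrelation of the curve\<close>

definition corr :: "real \<Rightarrow> real" where
  "corr x = integral {0..2*pi} (\<lambda>s. Re (c (s + x) * cnj (c s)))"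

text \<open>The \<open>V\<close> of the overview, taken as an integral over a period rather than as
  a mean.\<close>

definition chord :: "real \<Rightarrow> real" where
  "chord x = integral {0..2*pi} (\<lambda>s. (norm (c (s + x) - c s))\<^sup>2)"

lemma continuous_corr: "continuous_on A corr"
  unfolding corr_def cbox_interval[symmetric]
  by (intro integral_continuous_on_param) (auto simp: split_def intro!: continuous_intros continuous_c)

lemma chord_corr: "chord x = 4 * pi - 2 * corr x"
proof -
  have "chord x = integral {0..2*pi} (\<lambda>s. 2 - 2 * Re (c (s + x) * cnj (c s)))"
    unfolding chord_def
  proof (intro integral_cong)
    fix s
    have "(norm (c (s + x) - c s))\<^sup>2 = (norm (c (s + x)))\<^sup>2 + (norm (c s))\<^sup>2 - 2 * Re (c (s + x) * cnj (c s))"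
      unfolding cmod_power2 by (simp add: power2_eq_square algebra_simps)
    then show "(norm (c (s + x) - c s))\<^sup>2 = 2 - 2 * Re (c (s + x) * cnj (c s))" by simp
  qed
  also have "\<dots> = integral {0..2*pi} (\<lambda>s. 2) - integral {0..2*pi} (\<lambda>s. 2 * Re (c (s + x) * cnj (c s)))"
    by (intro integral_diff integrable_continuous_real continuous_intros continuous_c)
  finally show ?thesis by (simp add: corr_def del: times_complex.sel)
qed

lemma continuous_chord: "continuous_on A chord"
  unfolding chord_corr[abs_def] by (intro continuous_intros continuous_corr)

text \<open>The pointwise inequality is integrated over \<open>s\<close>; periodicity lets the
  second chord start at \<open>s + x\<close> instead of \<open>s\<close>.\<close>

lemma chord_superadditive:
  assumes "0 \<le> x" "0 \<le> y" "x + y \<le> pi"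
  shows "chord x + chord y \<le> chord (x + y)"
proof -
  have int: "(\<lambda>s. (norm (c (s + a) - c (s + b)))\<^sup>2) integrable_on {0..2*pi}" for a b
    by (intro integrable_continuous_real continuous_intros continuous_c)
  have "chord y = integral {0..2*pi} (\<lambda>s. (\<lambda>s. (norm (c (s + y) - c s))\<^sup>2) (s + x))"
    unfolding chord_def
  proof (rule integral_periodic_shift[symmetric])
    show "continuous_on UNIV (\<lambda>s. (norm (c (s + y) - c s))\<^sup>2)"
      by (intro continuous_intros continuous_c)
    show "(norm (c (t + 2 * pi + y) - c (t + 2 * pi)))\<^sup>2 = (norm (c (t + y) - c t))\<^sup>2" for t
    proof -
      have "t + 2 * pi + y = (t + y) + 2 * pi" by simp
      then show ?thesis by (simp only: periodic)
    qed
  qed (use assms in auto)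
  then have "chord x + chord y
      = integral {0..2*pi} (\<lambda>s. (norm (c (s + x) - c s))\<^sup>2 + (norm (c (s + x + y) - c (s + x)))\<^sup>2)"
    unfolding chord_def using integral_add[OF int[of x 0] int[of "x + y" x]] by (simp add: add.assoc)
  also have "\<dots> \<le> integral {0..2*pi} (\<lambda>s. (norm (c (s + x + y) - c s))\<^sup>2)"
    by (intro integral_le integrable_continuous_real continuous_intros continuous_c chords_superadditive assms)
  finally show ?thesis by (simp add: chord_def add.assoc)
qed

lemma corr_shift_pi: "corr (x + pi) = - corr x"
proof -
  have "corr (x + pi) = integral {0..2*pi} (\<lambda>s. - Re (c (s + x) * cnj (c s)))"
    unfolding corr_def using anti[of "_ + x"] by (intro integral_cong) (simp add: add.assoc[symmetric])
  then show ?thesis by (simp only: corr_def integral_neg)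
qed

text \<open>Moving the base point from \<open>s\<close> to \<open>s + x\<close> gives the product
  \<open>c (s + pi) * cnj (c (s + x))\<close>. Antiperiodicity produces the sign, and conjugation
  leaves the real part unchanged. At \<open>pi / 2\<close> this forces the correlation to
  vanish.\<close>

lemma corr_reflect:
  assumes "0 \<le> x" "x \<le> pi"
  shows "corr (pi - x) = - corr x"
proof -
  have "corr (pi - x) = integral {0..2*pi} (\<lambda>s. (\<lambda>s. Re (c (s + (pi - x)) * cnj (c s))) (s + x))"
    unfolding corr_def
  proof (rule integral_periodic_shift[symmetric])
    show "continuous_on UNIV (\<lambda>s. Re (c (s + (pi - x)) * cnj (c s)))"
      by (intro continuous_intros continuous_c)
    show "Re (c (t + 2 * pi + (pi - x)) * cnj (c (t + 2 * pi))) = Re (c (t + (pi - x)) * cnj (c t))" for t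
    proof -
      have "t + 2 * pi + (pi - x) = (t + (pi - x)) + 2 * pi" by simp
      then show ?thesis by (simp only: periodic)
    qed
  qed (use assms in auto)
  also have "\<dots> = integral {0..2*pi} (\<lambda>s. - Re (c (s + x) * cnj (c s)))"
    by (intro integral_cong) (simp add: anti algebra_simps)
  finally show ?thesis by (simp only: corr_def integral_neg)
qed

lemma chord_half_pi: "chord (pi / 2) = 4 * pi"
  using corr_reflect[of "pi / 2"] by (simp add: chord_corr)

section \<open>Growth of the cumulative chord integral and the cosine integrals\<close>

text \<open>The \<open>K\<close> of the overview.\<close>

definition cumchord :: "real \<Rightarrow> real" where
  "cumchord a = integral {0..a} chord"

lemma cumchord_deriv:
  assumes "0 < x"
  shows "(cumchord has_real_derivative chord x) (at x)"
proof -
  have "(cumchord has_real_derivative chord x) (at x within {0..x + 1})"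
    unfolding cumchord_def using assms by (intro integral_has_real_derivative continuous_chord) auto
  then show ?thesis using assms by (simp add: at_within_Icc_at)
qed

lemma cumchord_continuous: "continuous_on {0..b} cumchord"
  unfolding cumchord_def by (intro indefinite_integral_continuous_1 integrable_continuous_real continuous_chord)

text \<open>Pairing \<open>x\<close> with \<open>a - x\<close>, superadditivity bounds the two
  chords together by \<open>chord a\<close>; integrating over \<open>[0, a]\<close> counts
  \<open>cumchord a\<close> twice.\<close>

lemma cumchord_le:
  assumes "0 \<le> a" "a \<le> pi"
  shows "cumchord a \<le> a / 2 * chord a"
proof -
  have int: "chord integrable_on {0..a}" by (intro integrable_continuous_real continuous_chord)
  have int': "(\<lambda>x. chord (a - x)) integrable_on {0..a}"
    by (intro integrable_continuous_real continuous_on_compose2[OF continuous_chord] continuous_intros) auto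
  have refl: "integral {0..a} (\<lambda>x. chord (a - x)) = cumchord a"
    using integral_shift_real_ivl[of "- a" "- a" 0 "\<lambda>x. chord (- x)"] Henstock_Kurzweil_Integration.integral_reflect_real[of a 0 chord]
    by (simp add: cumchord_def)
  have "cumchord a + cumchord a = integral {0..a} (\<lambda>x. chord x + chord (a - x))"
    using integral_add[OF int int'] refl by (simp add: cumchord_def)
  also have "\<dots> \<le> integral {0..a} (\<lambda>x. chord a)"
  proof (rule integral_le)
    show "(\<lambda>x. chord x + chord (a - x)) integrable_on {0..a}"
      by (intro integrable_add int int')
    show "chord x + chord (a - x) \<le> chord a" if "x \<in> {0..a}" for x
      using chord_superadditive[of x "a - x"] that assms by auto
  qed auto
  finally show ?thesis using assms by simp
qed

text \<open>By \<open>cumchord_le\<close> the quotient \<open>cumchord a / a\<^sup>2\<close> is nondecreasing, so its value at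
  \<open>pi / 2\<close>, which is at most 4, bounds it.\<close>
lemma cumchord_le_square:
  assumes a: "0 \<le> a" "a \<le> pi / 2"
  shows "cumchord a \<le> 4 * a\<^sup>2"
proof (cases "a = 0")
  case True
  then show ?thesis by (simp add: cumchord_def)
next
  case False
  then have a: "0 < a" "a \<le> pi / 2" using a by auto
  have "cumchord a / a\<^sup>2 \<le> cumchord (pi / 2) / (pi / 2)\<^sup>2"
  proof (rule DERIV_nonneg_imp_nondecreasing[OF a(2)])
    fix x assume x: "a \<le> x" "x \<le> pi / 2"
    then have "x > 0" using a by simp
    have "((\<lambda>x. cumchord x / x\<^sup>2) has_real_derivative
        (chord x * x\<^sup>2 - cumchord x * (2 * x)) / (x\<^sup>2 * x\<^sup>2)) (at x)"
      using \<open>x > 0\<close> by (auto intro!: derivative_eq_intros cumchord_deriv)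
    moreover have "cumchord x * 2 \<le> x * chord x" using cumchord_le[of x] x \<open>x > 0\<close> by simp
    then have "x * (cumchord x * 2) \<le> x * (x * chord x)" using \<open>x > 0\<close> by simp
    then have "0 \<le> chord x * x\<^sup>2 - cumchord x * (2 * x)"
      by (simp add: power2_eq_square algebra_simps)
    then have "0 \<le> (chord x * x\<^sup>2 - cumchord x * (2 * x)) / (x\<^sup>2 * x\<^sup>2)" by simp
    ultimately show "\<exists>y. ((\<lambda>x. cumchord x / x\<^sup>2) has_real_derivative y) (at x) \<and> y \<ge> 0" by blast
  qed
  \<comment> \<open>Here \<open>cumchord (pi / 2) \<le> pi / 4 * (4 * pi)\<close>, which is four
    times \<open>(pi / 2)\<^sup>2\<close>.\<close>
  also have "\<dots> \<le> 4"
    using cumchord_le[of "pi / 2"] by (simp add: chord_half_pi power2_eq_square field_simps)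
  finally show ?thesis using a by (simp add: field_simps)
qed

lemma integral_cos_chord_le: "integral {0..pi/2} (\<lambda>x. cos x * chord x) \<le> 4 * (pi - 2)"
proof -
  \<comment> \<open>Integration by parts in the form of an explicit primitive: the second summand of
    \<open>\<Phi>\<close> is a primitive of \<open>4 * x\<^sup>2 * sin x\<close>. Its derivative
    \<open>\<phi>\<close> exceeds the integrand by a term that \<open>cumchord_le_square\<close>
    makes nonnegative.\<close>
  define \<Phi> where "\<Phi> x = cos x * cumchord x + 4 * (2 * x * sin x + 2 * cos x - x\<^sup>2 * cos x)" for x
  define \<phi> where "\<phi> x = cos x * chord x + sin x * (4 * x\<^sup>2 - cumchord x)" for x
  have "(\<phi> has_integral (\<Phi> (pi / 2) - \<Phi> 0)) {0..pi/2}"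
  proof (rule fundamental_theorem_of_calculus_interior)
    show "continuous_on {0..pi/2} \<Phi>" unfolding \<Phi>_def by (intro continuous_intros cumchord_continuous)
    show "(\<Phi> has_vector_derivative \<phi> x) (at x)" if "x \<in> {0<..<pi/2}" for x
      unfolding has_real_derivative_iff_has_vector_derivative[symmetric] \<Phi>_def \<phi>_def
      using that by (auto intro!: derivative_eq_intros cumchord_deriv simp: power2_eq_square algebra_simps)
  qed auto
  moreover have "\<Phi> (pi / 2) - \<Phi> 0 = 4 * (pi - 2)" by (simp add: \<Phi>_def cumchord_def)
  ultimately have \<phi>: "(\<phi> has_integral 4 * (pi - 2)) {0..pi/2}" by simp
  have "integral {0..pi/2} (\<lambda>x. cos x * chord x) \<le> integral {0..pi/2} \<phi>"
  proof (rule integral_le)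
    show "(\<lambda>x. cos x * chord x) integrable_on {0..pi/2}"
      by (intro integrable_continuous_real continuous_intros continuous_chord)
    show "\<phi> integrable_on {0..pi/2}" using \<phi> by blast
    show "cos x * chord x \<le> \<phi> x" if "x \<in> {0..pi/2}" for x
      using cumchord_le_square[of x] that sin_ge_zero[of x] by (auto simp: \<phi>_def)
  qed
  then show ?thesis using \<phi> by (simp add: integral_unique)
qed

text \<open>Since \<open>cos\<close> has integral 1 over the quarter period,
  \<open>chord_corr\<close> turns the bound on chords into
  \<open>4 * pi - 2 * I \<le> 4 * pi - 8\<close> for the integral \<open>I\<close> in
  question.\<close>

lemma integral_cos_corr_quarter: "integral {0..pi/2} (\<lambda>x. cos x * corr x) \<ge> 4"
proof -
  have "((\<lambda>x. cos x) has_integral (sin (pi / 2) - sin 0)) {0..pi/2}"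
    by (rule fundamental_theorem_of_calculus)
      (auto simp: has_real_derivative_iff_has_vector_derivative[symmetric] intro!: derivative_eq_intros)
  then have 1: "integral {0..pi/2} cos = 1" by (simp add: integral_unique)
  have "integral {0..pi/2} (\<lambda>x. cos x * chord x)
      = integral {0..pi/2} (\<lambda>x. 4 * pi * cos x - 2 * (cos x * corr x))"
    by (intro integral_cong) (simp add: chord_corr algebra_simps)
  also have "\<dots> = integral {0..pi/2} (\<lambda>x. 4 * pi * cos x) - integral {0..pi/2} (\<lambda>x. 2 * (cos x * corr x))"
    by (intro integral_diff integrable_continuous_real continuous_intros continuous_corr)
  also have "\<dots> = 4 * pi - 2 * integral {0..pi/2} (\<lambda>x. cos x * corr x)" using 1 by simp
  finally show ?thesis using integral_cos_chord_le by simp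
qed

text \<open>Both \<open>cos\<close> and \<open>corr\<close> change sign under \<open>x + pi\<close>
  and under \<open>pi - x\<close>, so their product contributes equally on the four quarter
  periods.\<close>

lemma integral_cos_corr: "integral {0..2*pi} (\<lambda>x. cos x * corr x) \<ge> 16"
proof -
  define p where "p x = cos x * corr x" for x
  have int: "p integrable_on {a..b}" for a b
    unfolding p_def by (intro integrable_continuous_real continuous_intros continuous_corr)
  have per: "p (x + pi) = p x" for x by (simp add: p_def corr_shift_pi)
  have refl: "p (pi - x) = p x" if "x \<in> {0..pi/2}" for x
    using corr_reflect[of x] that by (simp add: p_def)
  have "integral {pi..2*pi} p = integral {0..pi} (\<lambda>x. p (x + pi))"
    using integral_shift_real_ivl[of pi pi "2*pi" p] by simp
  then have "integral {0..2*pi} p = 2 * integral {0..pi} p"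
    using Henstock_Kurzweil_Integration.integral_combine[of 0 pi "2*pi" p] int by (simp add: per)
  moreover have "integral {pi/2..pi} p = integral {0..pi/2} (\<lambda>x. p (pi - x))"
    using integral_shift_real_ivl[of "- pi" "- pi" "- (pi / 2)" "\<lambda>x. p (- x)"]
      Henstock_Kurzweil_Integration.integral_reflect_real[of pi "pi / 2" p] by simp
  then have "integral {pi/2..pi} p = integral {0..pi/2} p"
    using integral_cong[of "{0..pi/2}" "\<lambda>x. p (pi - x)" p] refl by simp
  then have "integral {0..pi} p = 2 * integral {0..pi/2} p"
    using Henstock_Kurzweil_Integration.integral_combine[of 0 "pi/2" pi p] int by simp
  ultimately show ?thesis using integral_cos_corr_quarter by (simp add: p_def[abs_def])
qed

text \<open>\<open>corr\<close> is the sum of the autocorrelations of the two real coordinates of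
  \<open>c\<close>; applying the autocorrelation identity to each and regrouping gives the squared
  moduli.\<close>

lemma fourier_lower_bound:
  "(norm (integral {0..2*pi} (\<lambda>t. c t * of_real (cos t))))\<^sup>2
    + (norm (integral {0..2*pi} (\<lambda>t. c t * of_real (sin t))))\<^sup>2 \<ge> 16"
proof -
  define u v where "u t = Re (c t)" and "v t = Im (c t)" for t
  have cu: "continuous_on A (\<lambda>x. u (g x))" and cv: "continuous_on A (\<lambda>x. v (g x))"
    if "continuous_on A g" for A :: "'b::topological_space set" and g
    using that unfolding u_def v_def by (auto intro!: continuous_intros continuous_c)
  have per: "u (t + 2 * pi) = u t" "v (t + 2 * pi) = v t" for t by (simp_all add: u_def v_def periodic)
  let ?U = "\<lambda>x. integral {0..2*pi} (\<lambda>s. u (s + x) * u s)" and ?V = "\<lambda>x. integral {0..2*pi} (\<lambda>s. v (s + x) * v s)"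
  have cU: "continuous_on A ?U" and cV: "continuous_on A ?V" for A
    unfolding cbox_interval[symmetric]
    by (intro integral_continuous_on_param; auto simp: split_def intro!: continuous_intros cu cv)+
  have "corr x = ?U x + ?V x" for x
    unfolding corr_def
    by (subst integral_add[symmetric])
      (auto simp: u_def[symmetric] v_def[symmetric] intro!: integrable_continuous_real continuous_intros cu cv)
  then have "integral {0..2*pi} (\<lambda>x. cos x * corr x) = integral {0..2*pi} (\<lambda>x. cos x * ?U x + cos x * ?V x)"
    by (simp add: distrib_left)
  also have "\<dots> = integral {0..2*pi} (\<lambda>x. cos x * ?U x) + integral {0..2*pi} (\<lambda>x. cos x * ?V x)"
    by (intro integral_add integrable_continuous_real continuous_intros cU cV)
  also have "\<dots> = (integral {0..2*pi} (\<lambda>t. u t * cos t))\<^sup>2 + (integral {0..2*pi} (\<lambda>t. u t * sin t))\<^sup>2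
      + ((integral {0..2*pi} (\<lambda>t. v t * cos t))\<^sup>2 + (integral {0..2*pi} (\<lambda>t. v t * sin t))\<^sup>2)"
    using per by (subst (1 2) integral_cos_autocorrelation) (auto intro!: cu cv)
  finally have sum: "\<dots> \<ge> 16" using integral_cos_corr by simp
  have split: "(norm (integral {0..2*pi} (\<lambda>t. c t * of_real (w t))))\<^sup>2
      = (integral {0..2*pi} (\<lambda>t. u t * w t))\<^sup>2 + (integral {0..2*pi} (\<lambda>t. v t * w t))\<^sup>2"
    if w: "continuous_on {0..2*pi} w" for w :: "real \<Rightarrow> real"
  proof -
    have int: "(\<lambda>t. c t * of_real (w t)) integrable_on {0..2*pi}"
      by (intro integrable_continuous_real continuous_intros continuous_c w)
    have "Re (integral {0..2*pi} (\<lambda>t. c t * of_real (w t))) = integral {0..2*pi} (\<lambda>t. u t * w t)"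
      using integral_linear[OF int bounded_linear_Re] by (simp add: o_def u_def)
    moreover have "Im (integral {0..2*pi} (\<lambda>t. c t * of_real (w t))) = integral {0..2*pi} (\<lambda>t. v t * w t)"
      using integral_linear[OF int bounded_linear_Im] by (simp add: o_def v_def)
    ultimately show ?thesis by (simp add: cmod_power2)
  qed
  show ?thesis using sum by (simp add: split continuous_intros)
qed

end

section \<open>First coefficients of a harmonic map as boundary integrals\<close>

lemma holomorphic_circle_integrals:
  fixes h :: "complex \<Rightarrow> complex"
  assumes h: "h holomorphic_on ball 0 1" and r: "0 < r" "r < 1"
  shows "((\<lambda>t. h (of_real r * cis t) * cis (- t)) has_integral of_real (2 * pi * r) * deriv h 0) {0..2*pi}"
    and "((\<lambda>t. h (of_real r * cis t) * cis t) has_integral 0) {0..2*pi}"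
proof -
  have sub: "cball 0 r \<subseteq> ball (0::complex) 1" using r by auto
  have hol: "h holomorphic_on ball 0 r" and cont: "continuous_on (cball 0 r) h"
    using holomorphic_on_subset[OF h] sub ball_subset_cball
    by (blast intro: holomorphic_on_imp_continuous_on)+
  have "((\<lambda>u. h u / (u - 0) ^ Suc 1) has_contour_integral
      ((2 * pi * \<i>) / fact 1 * (deriv ^^ 1) h 0)) (circlepath 0 r)"
    by (rule Cauchy_has_contour_integral_higher_derivative_circlepath[OF cont hol]) (use r in auto)
  then have "((\<lambda>t. h (of_real r * cis t) / (of_real r * cis t)\<^sup>2 * r * \<i> * cis t)
      has_integral (2 * pi * \<i> * deriv h 0)) {0..2*pi}"
    unfolding circlepath_def by (subst (asm) has_contour_integral_part_circlepath_iff) (auto simp: power2_eq_square)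
  \<comment> \<open>This factor reduces the Cauchy kernel times the differential
    \<open>of_real r * \<i> * cis t\<close> to \<open>cis (- t)\<close>.\<close>
  from has_integral_mult_right[OF this, of "of_real r / \<i>"]
  have "((\<lambda>t. of_real r / \<i> * (h (of_real r * cis t) / (of_real r * cis t)\<^sup>2 * r * \<i> * cis t))
      has_integral (of_real (2 * pi * r) * deriv h 0)) {0..2*pi}"
    by (simp add: mult_ac)
  moreover have "of_real r / \<i> * (h (of_real r * cis t) / (of_real r * cis t)\<^sup>2 * r * \<i> * cis t)
      = h (of_real r * cis t) * cis (- t)" for t
  proof -
    have "of_real r / \<i> * (x / (of_real r * cis t)\<^sup>2 * r * \<i> * cis t) = x / cis t" for x
      using r by (simp add: field_simps power2_eq_square del: cis_divide cis_mult)
    then show ?thesis by (simp add: divide_inverse)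
  qed
  ultimately show "((\<lambda>t. h (of_real r * cis t) * cis (- t)) has_integral of_real (2 * pi * r) * deriv h 0) {0..2*pi}"
    by simp
  have "(h has_contour_integral 0) (circlepath 0 r)"
    by (rule Cauchy_theorem_convex_simple[OF h]) (use r in auto)
  then have "((\<lambda>t. h (of_real r * cis t) * r * \<i> * cis t) has_integral 0) {0..2*pi}"
    unfolding circlepath_def by (subst (asm) has_contour_integral_part_circlepath_iff) auto
  from has_integral_mult_right[OF this, of "1 / (\<i> * of_real r)"]
  show "((\<lambda>t. h (of_real r * cis t) * cis t) has_integral 0) {0..2*pi}"
    using r by (simp add: mult_ac)
qed

text \<open>Conjugating the integrals of \<open>g\<close> exchanges the two frequencies, so each
  integral sees only one of \<open>h\<close> and \<open>g\<close>.\<close>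

lemma harm_circle_integrals:
  assumes h: "h holomorphic_on ball 0 1" and g: "g holomorphic_on ball 0 1" and r: "0 < r" "r < 1"
  shows "((\<lambda>t. harm h g (of_real r * cis t) * cis (- t)) has_integral of_real (2 * pi * r) * deriv h 0) {0..2*pi}"
    and "((\<lambda>t. harm h g (of_real r * cis t) * cis t) has_integral of_real (2 * pi * r) * cnj (deriv g 0)) {0..2*pi}"
proof -
  note H = holomorphic_circle_integrals[OF h r]
  have G1: "((\<lambda>t. cnj (g (of_real r * cis t)) * cis t) has_integral of_real (2 * pi * r) * cnj (deriv g 0)) {0..2*pi}"
    using has_integral_cnj[THEN iffD2, OF holomorphic_circle_integrals(1)[OF g r]]
    by (simp add: o_def cis_cnj)
  have G2: "((\<lambda>t. cnj (g (of_real r * cis t)) * cis (- t)) has_integral 0) {0..2*pi}"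
    using has_integral_cnj[THEN iffD2, OF holomorphic_circle_integrals(2)[OF g r]]
    by (simp add: o_def cis_cnj)
  show "((\<lambda>t. harm h g (of_real r * cis t) * cis (- t)) has_integral of_real (2 * pi * r) * deriv h 0) {0..2*pi}"
    using has_integral_add[OF H(1) G2] by (simp add: harm_def distrib_right)
  show "((\<lambda>t. harm h g (of_real r * cis t) * cis t) has_integral of_real (2 * pi * r) * cnj (deriv g 0)) {0..2*pi}"
    using has_integral_add[OF H(2) G1] by (simp add: harm_def distrib_right)
qed

text \<open>The circle integrals depend continuously on the radius in \<open>[0, 1]\<close>, so an
  identity valid for \<open>0 < r < 1\<close> passes to the boundary.\<close>

lemma circle_integral_boundary_limit:
  fixes F :: "complex \<Rightarrow> complex"
  assumes F: "continuous_on (cball 0 1) F" and w: "continuous_on UNIV w"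
    and eq: "\<And>r. 0 < r \<Longrightarrow> r < 1 \<Longrightarrow> integral {0..2*pi} (\<lambda>t. F (of_real r * cis t) * w t) = of_real r * L"
  shows "integral {0..2*pi} (\<lambda>t. F (cis t) * w t) = L"
proof -
  have cF: "continuous_on ({0..1} \<times> {0..2*pi}) (\<lambda>x::real\<times>real. F (of_real (fst x) * cis (snd x)))"
    by (rule continuous_on_compose2[OF F]) (auto intro!: continuous_intros simp: norm_mult)
  have cw: "continuous_on A (\<lambda>x. w (g x))" if "continuous_on A g" for A :: "(real \<times> real) set" and g
    by (rule continuous_on_compose2[OF w that]) simp
  have "continuous_on {0..1::real} (\<lambda>r. integral {0..2*pi} (\<lambda>t. F (of_real r * cis t) * w t))"
    unfolding cbox_interval[symmetric, of 0 "2*pi"]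
    by (rule integral_continuous_on_param) (auto simp: split_def intro!: continuous_intros cF cw)
  then have "continuous_on (closure {0<..<1::real}) (\<lambda>r. integral {0..2*pi} (\<lambda>t. F (of_real r * cis t) * w t) - of_real r * L)"
    by (auto intro!: continuous_intros)
  then have "integral {0..2*pi} (\<lambda>t. F (of_real 1 * cis t) * w t) - of_real 1 * L = 0"
    by (rule continuous_constant_on_closure) (auto simp: eq)
  then show ?thesis by simp
qed

lemma odd_boundary_curve:
  assumes F: "homeomorphism (cball 0 1) (cball 0 1) F F'"
    and bij: "bij_betw f (ball 0 1) (ball 0 1)" and Ff: "\<And>z. z \<in> ball 0 1 \<Longrightarrow> F z = f z"
    and odd: "\<And>\<zeta>. \<zeta> \<in> sphere 0 1 \<Longrightarrow> F (- \<zeta>) = - F \<zeta>"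
  shows "odd_circle_curve (\<lambda>t. F (cis t))"
proof
  have inj: "inj_on F (cball 0 1)" using homeomorphism_apply1[OF F] by (rule inj_on_inverseI)
  show "continuous_on UNIV (\<lambda>t. F (cis t))"
    by (rule continuous_on_compose2[OF homeomorphism_cont1[OF F]]) (auto intro!: continuous_intros)
  show "norm (F (cis t)) = 1" for t
  \<comment> \<open>A boundary point sent into the open disc would share its image with an interior
    point, because \<open>f\<close> already covers the open disc. Injectivity of \<open>F\<close>
    excludes this.\<close>
  proof (rule ccontr)
    assume "norm (F (cis t)) \<noteq> 1"
    moreover have "F (cis t) \<in> cball 0 1" using homeomorphism_image1[OF F] by (metis imageI mem_cball_0 norm_cis order_refl)
    ultimately have "F (cis t) \<in> f ` ball 0 1" using bij by (auto simp: bij_betw_def)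
    then obtain w where w: "w \<in> ball 0 1" "F (cis t) = F w" using Ff by force
    then have "cis t = w" using inj by (auto simp: inj_on_def)
    then show False using w by auto
  qed
  show "F (cis (t + pi)) = - F (cis t)" for t
    using odd[of "cis t"] by (simp flip: cis_mult)
  show "F (cis s) \<noteq> F (cis t)" if "s < t" "t < s + 2 * pi" for s t
  proof
    assume "F (cis s) = F (cis t)"
    then have "cis s = cis t" using inj by (auto simp: inj_on_def)
    then have "cis (t - s) = 1" by (simp flip: cis_divide)
    then have "cos (t - s) = 1" by (simp add: complex_eq_iff)
    then obtain n :: int where "t - s = of_int n * (2 * pi)" using cos_one_2pi_int by (metis mult.assoc)
    then have "0 < of_int n * (2 * pi)" "of_int n * (2 * pi) < 1 * (2 * pi)" using that by linarith+
    then have "0 < n" "n < 1" by (simp_all add: zero_less_mult_iff mult_less_cancel_right)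
    then show False by simp
  qed
qed

lemma odd_admissible_lower_bound:
  assumes "odd_admissible h g"
  shows "(norm (deriv h 0))\<^sup>2 + (norm (deriv g 0))\<^sup>2 \<ge> 8 / pi\<^sup>2"
proof -
  obtain F F' where h: "h holomorphic_on ball 0 1" and g: "g holomorphic_on ball 0 1"
    and bij: "bij_betw (harm h g) (ball 0 1) (ball 0 1)"
    and FH: "\<And>z. z \<in> ball 0 1 \<Longrightarrow> F z = harm h g z"
    and F: "homeomorphism (cball 0 1) (cball 0 1) F F'"
    and odd: "\<And>\<zeta>. \<zeta> \<in> sphere 0 1 \<Longrightarrow> F (- \<zeta>) = - F \<zeta>"
    using assms unfolding odd_admissible_def by blast
  interpret odd_circle_curve "\<lambda>t. F (cis t)"
    by (rule odd_boundary_curve[OF F bij FH odd])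
  \<comment> \<open>The conjugate appears because \<open>cnj (deriv g 0)\<close> is the coefficient
    of \<open>cis (- t)\<close> in the boundary function.\<close>
  define a b where "a = deriv h 0" and "b = cnj (deriv g 0)"
  have cF: "continuous_on (cball 0 1) F" using F by (rule homeomorphism_cont1)
  have FHr: "F (of_real r * cis t) = harm h g (of_real r * cis t)" if "0 < r" "r < 1" for r t
    using that by (intro FH) (simp add: norm_mult)
  have a: "integral {0..2*pi} (\<lambda>t. F (cis t) * cis (- t)) = 2 * pi * a"
    by (rule circle_integral_boundary_limit[OF cF])
      (auto intro!: continuous_intros simp: FHr integral_unique[OF harm_circle_integrals(1)[OF h g]] a_def)
  have b: "integral {0..2*pi} (\<lambda>t. F (cis t) * cis t) = 2 * pi * b"
    by (rule circle_integral_boundary_limit[OF cF])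
      (auto intro!: continuous_intros simp: FHr integral_unique[OF harm_circle_integrals(2)[OF h g]] b_def)
  have int: "(\<lambda>t. F (cis t) * cis (- t)) integrable_on {0..2*pi}" "(\<lambda>t. F (cis t) * cis t) integrable_on {0..2*pi}"
    by (intro integrable_continuous_real continuous_intros continuous_c)+
  have "integral {0..2*pi} (\<lambda>t. F (cis t) * of_real (cos t))
      = integral {0..2*pi} (\<lambda>t. (F (cis t) * cis (- t) + F (cis t) * cis t) / 2)"
    by (intro integral_cong) (simp add: complex_eq_iff algebra_simps)
  also have "\<dots> = pi * (a + b)" by (simp add: integral_add[OF int] a b distrib_left)
  finally have C: "integral {0..2*pi} (\<lambda>t. F (cis t) * of_real (cos t)) = pi * (a + b)" .
  have "integral {0..2*pi} (\<lambda>t. F (cis t) * of_real (sin t))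
      = integral {0..2*pi} (\<lambda>t. (F (cis t) * cis (- t) - F (cis t) * cis t) * (\<i> / 2))"
    by (intro integral_cong) (simp add: complex_eq_iff field_simps)
  also have "\<dots> = pi * (a - b) * \<i>" by (simp add: integral_diff[OF int] a b right_diff_distrib)
  finally have S: "integral {0..2*pi} (\<lambda>t. F (cis t) * of_real (sin t)) = pi * (a - b) * \<i>" .
  have "16 \<le> (norm (pi * (a + b)))\<^sup>2 + (norm (pi * (a - b) * \<i>))\<^sup>2"
    using fourier_lower_bound unfolding C S .
  also have "\<dots> = pi\<^sup>2 * ((norm (a + b))\<^sup>2 + (norm (a - b))\<^sup>2)"
    by (simp add: norm_mult power_mult_distrib distrib_left[of "pi\<^sup>2"])
  \<comment> \<open>The parallelogram law removes the cross term between the two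
    coefficients.\<close>
  also have "(norm (a + b))\<^sup>2 + (norm (a - b))\<^sup>2 = 2 * ((norm a)\<^sup>2 + (norm b)\<^sup>2)"
    unfolding cmod_power2 by (simp add: power2_eq_square algebra_simps)
  finally have "8 \<le> pi\<^sup>2 * ((norm a)\<^sup>2 + (norm b)\<^sup>2)" by (simp add: algebra_simps)
  then show ?thesis by (subst pos_divide_le_eq) (simp_all add: a_def b_def mult.commute)
qed

section \<open>Sharpness\<close>

text \<open>The Cayley transform sends the right half plane to the disc and \<open>q z0\<close> to
  0. After rescaling the ball, the Schwarz lemma for \<open>T\<close> gives both estimates.\<close>

lemma halfplane_schwarz:
  assumes q: "q holomorphic_on ball z0 R" and R: "R > 0"
    and pos: "\<And>z. z \<in> ball z0 R \<Longrightarrow> Re (q z) > 0"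
  shows "norm (deriv q z0) \<le> 2 * Re (q z0) / R"
    and "z \<in> ball z0 R \<Longrightarrow> norm (q z - q z0) \<le> norm (z - z0) / R * norm (q z + cnj (q z0))"
proof -
  define c where "c = q z0"
  have c: "Re c > 0" using pos R by (simp add: c_def)
  have nz: "w + cnj c \<noteq> 0" if "Re w > 0" for w
  proof
    assume "w + cnj c = 0"
    then have "Re (w + cnj c) = 0" by simp
    then show False using that c by simp
  qed
  define T where "T u = (q (z0 + of_real R * u) - c) / (q (z0 + of_real R * u) + cnj c)" for u
  have mem: "z0 + of_real R * u \<in> ball z0 R" if "u \<in> ball 0 1" for u
    using that R by (simp add: dist_norm norm_mult)
  have holq: "(\<lambda>u. q (z0 + of_real R * u)) holomorphic_on ball 0 1"
    using mem by (intro holomorphic_on_compose_gen[OF _ q, unfolded o_def] holomorphic_intros) auto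
  have holT: "T holomorphic_on ball 0 1"
    unfolding T_def using nz pos mem by (intro holomorphic_intros holq) auto
  have T0: "T 0 = 0" by (simp add: T_def c_def)
  have lt: "norm (w - c) < norm (w + cnj c)" if "Re w > 0" for w
  proof -
    have "(norm (w + cnj c))\<^sup>2 - (norm (w - c))\<^sup>2 = 4 * Re w * Re c"
      unfolding cmod_power2 by (simp add: power2_eq_square algebra_simps)
    then have "(norm (w - c))\<^sup>2 < (norm (w + cnj c))\<^sup>2" using that c by (smt (verit) mult_pos_pos)
    then show ?thesis by (simp add: power2_less_imp_less)
  qed
  have T1: "norm (T u) < 1" if "norm u < 1" for u
  proof -
    have "Re (q (z0 + of_real R * u)) > 0" using pos mem that by simp
    then show ?thesis using lt nz by (simp add: T_def norm_divide divide_simps)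
  qed
  note S = Schwarz_Lemma[OF holT T0 T1]
  have dq: "(q has_field_derivative deriv q z0) (at z0)"
    using q R by (intro holomorphic_derivI[of _ "ball z0 R"]) auto
  have "((\<lambda>u. z0 + of_real R * u) has_field_derivative of_real R) (at 0)"
    by (auto intro!: derivative_eq_intros)
  then have dc: "((\<lambda>u. q (z0 + of_real R * u)) has_field_derivative (deriv q z0 * of_real R)) (at 0)"
    using dq by (intro DERIV_chain2[of q "deriv q z0"]) auto
  have cc: "c + cnj c \<noteq> 0" using nz c by blast
  have "(T has_field_derivative
      ((deriv q z0 * of_real R - 0) * (q (z0 + of_real R * 0) + cnj c)
        - (q (z0 + of_real R * 0) - c) * (deriv q z0 * of_real R + 0))
      / ((q (z0 + of_real R * 0) + cnj c) * (q (z0 + of_real R * 0) + cnj c))) (at 0)"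
    unfolding T_def
    by (intro DERIV_divide DERIV_diff DERIV_add DERIV_const dc) (use cc in \<open>simp add: c_def\<close>)
  then have "(T has_field_derivative (deriv q z0 * of_real R / (c + cnj c))) (at 0)"
    using cc by (simp add: c_def[symmetric])
  then have "deriv T 0 = deriv q z0 * of_real R / (c + cnj c)" by (rule DERIV_imp_deriv)
  moreover have "c + cnj c = of_real (2 * Re c)" by (simp add: complex_eq_iff)
  ultimately have "norm (deriv T 0) = norm (deriv q z0) * R / (2 * Re c)"
    using R c by (simp add: norm_mult norm_divide)
  moreover have "norm (deriv T 0) \<le> 1" using S(2)[of 0] by (simp only: norm_zero zero_less_one)
  ultimately show "norm (deriv q z0) \<le> 2 * Re (q z0) / R"
    using R c unfolding c_def[symmetric] by (simp add: divide_le_eq pos_le_divide_eq mult.commute)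
  assume z: "z \<in> ball z0 R"
  define u where "u = (z - z0) / of_real R"
  have u: "norm u = norm (z - z0) / R" "norm u < 1" "z0 + of_real R * u = z"
    using z R by (auto simp: u_def norm_divide dist_norm norm_minus_commute)
  have "norm (T u) \<le> norm u" using S(1) u(2) by blast
  moreover have "norm (T u) = norm (q z - c) / norm (q z + cnj c)"
    by (simp add: T_def u(3) norm_divide)
  moreover have "norm (q z + cnj c) > 0" using nz pos z by simp
  ultimately have "norm (q z - c) \<le> norm u * norm (q z + cnj c)"
    by (simp add: pos_divide_le_eq)
  then show "norm (q z - q z0) \<le> norm (z - z0) / R * norm (q z + cnj (q z0))"
    by (simp only: u(1) c_def)
qed

lemma halfplane_harnack:
  assumes q: "q holomorphic_on ball z0 R"
    and pos: "\<And>z. z \<in> ball z0 R \<Longrightarrow> Re (q z) > 0"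
    and z: "z \<in> ball z0 R"
  shows "Re (q z) \<ge> (R - norm (z - z0)) / (R + norm (z - z0)) * Re (q z0)"
proof -
  have R: "R > 0" using z by (metis ball_eq_empty empty_iff linorder_not_less)
  define t where "t = norm (z - z0) / R"
  have t: "0 \<le> t" "t < 1" using z R by (auto simp: t_def dist_norm norm_minus_commute)
  define x a y where "x = Re (q z)" and "a = Re (q z0)" and "y = Im (q z) - Im (q z0)"
  have xa: "x > 0" "a > 0" using pos z R by (auto simp: x_def a_def)
  have "norm (q z - q z0) \<le> t * norm (q z + cnj (q z0))"
    unfolding t_def by (rule halfplane_schwarz(2)[OF q R pos z])
  then have "(norm (q z - q z0))\<^sup>2 \<le> (t * norm (q z + cnj (q z0)))\<^sup>2"
    by (intro power_mono) auto
  then have "(x - a)\<^sup>2 + y\<^sup>2 \<le> t\<^sup>2 * ((x + a)\<^sup>2 + y\<^sup>2)"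
    by (simp add: power_mult_distrib cmod_power2 x_def a_def y_def)
  also have "\<dots> \<le> (t * (x + a))\<^sup>2 + y\<^sup>2"
  proof -
    have "t\<^sup>2 * y\<^sup>2 \<le> y\<^sup>2" using t by (intro mult_left_le_one_le) (auto simp: power_le_one)
    then show ?thesis
      using power_mult_distrib[of t "x + a" 2] distrib_left[of "t\<^sup>2" "(x + a)\<^sup>2" "y\<^sup>2"] by linarith
  qed
  finally have "(a - x)\<^sup>2 \<le> (t * (x + a))\<^sup>2" using power2_commute[of a x] by linarith
  then have "a - x \<le> t * (x + a)" by (rule power2_le_imp_le) (use t xa in auto)
  then have "(1 - t) * a \<le> (1 + t) * x" by (simp add: algebra_simps)
  then have "(1 - t) / (1 + t) * a \<le> x" using t by (simp add: divide_simps mult.commute)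
  moreover have "(1 - t) / (1 + t) = (R - norm (z - z0)) / (R + norm (z - z0))"
    using R by (simp add: t_def divide_simps)
  ultimately show ?thesis by (simp add: x_def a_def)
qed

text \<open>A unimodular factor \<open>n\<close> makes the value of \<open>G\<close> at one chosen
  point real and nonnegative, so \<open>1 - n * G\<close> maps to the right half plane and its real
  part at that point is the distance of \<open>G\<close> from the unit circle. The point is
  \<open>z0\<close> for the derivative and \<open>z\<close> for the Harnack bound.\<close>

lemma disc_valued_bounds:
  assumes G: "G holomorphic_on ball z0 R"
    and lt: "\<And>z. z \<in> ball z0 R \<Longrightarrow> norm (G z) < 1"
  shows "R > 0 \<Longrightarrow> norm (deriv G z0) \<le> 2 * (1 - norm (G z0)) / R"
    and "z \<in> ball z0 R \<Longrightarrow>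
      1 - norm (G z) \<ge> (R - norm (z - z0)) / (R + norm (z - z0)) * (1 - norm (G z0))"
proof -
  have unit: "\<exists>n::complex. norm n = 1 \<and> n * w = of_real (norm w)" for w
  proof (cases "w = 0")
    case False
    then have "cnj w / of_real (norm w) * w = of_real (norm w)"
      using complex_norm_square[of w] by (simp add: power2_eq_square mult.commute divide_eq_eq)
    then show ?thesis using False by (intro exI[of _ "cnj w / of_real (norm w)"]) (auto simp: norm_divide)
  qed (auto intro: exI[of _ 1])
  have pos: "Re (1 - n * G z) > 0" if "norm n = 1" "z \<in> ball z0 R" for n z
    using lt[OF that(2)] complex_Re_le_cmod[of "n * G z"] that(1) by (simp add: norm_mult)
  have hol: "(\<lambda>z. 1 - n * G z) holomorphic_on ball z0 R" for n by (intro holomorphic_intros G)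
  show "norm (deriv G z0) \<le> 2 * (1 - norm (G z0)) / R" if R: "R > 0"
  proof -
    obtain n where n: "norm n = 1" "n * G z0 = of_real (norm (G z0))" using unit by blast
    have "(G has_field_derivative deriv G z0) (at z0)"
      using G R by (intro holomorphic_derivI[of _ "ball z0 R"]) auto
    then have "((\<lambda>z. 1 - n * G z) has_field_derivative (- n * deriv G z0)) (at z0)"
      by (auto intro!: derivative_eq_intros)
    then have "deriv (\<lambda>z. 1 - n * G z) z0 = - n * deriv G z0" by (rule DERIV_imp_deriv)
    then show ?thesis
      using halfplane_schwarz(1)[OF hol R pos, of n] n by (simp add: norm_mult)
  qed
  assume z: "z \<in> ball z0 R"
  obtain n where n: "norm n = 1" "n * G z = of_real (norm (G z))" using unit by blast
  have "Re (n * G z0) \<le> norm (G z0)" using complex_Re_le_cmod[of "n * G z0"] n by (simp add: norm_mult)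
  then have "(R - norm (z - z0)) / (R + norm (z - z0)) * (1 - norm (G z0))
      \<le> (R - norm (z - z0)) / (R + norm (z - z0)) * Re (1 - n * G z0)"
    using z by (intro mult_left_mono divide_nonneg_nonneg)
      (auto simp: dist_norm norm_minus_commute intro: add_nonneg_nonneg order.trans[OF norm_ge_zero less_imp_le])
  also have "\<dots> \<le> Re (1 - n * G z)" by (rule halfplane_harnack[OF hol pos[OF n(1)] z])
  finally show "1 - norm (G z) \<ge> (R - norm (z - z0)) / (R + norm (z - z0)) * (1 - norm (G z0))"
    by (simp add: n(2))
qed

section \<open>Extension of homeomorphisms to closures\<close>

text \<open>Uniform continuity extends both maps to the closures; that they are inverse to each
  other persists by density, since the distances involved are continuous and vanish on
  \<open>S\<close> and \<open>T\<close>.\<close>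

lemma uniformly_continuous_inverse_extends:
  fixes f :: "'a::complete_space \<Rightarrow> 'b::complete_space"
  assumes f: "uniformly_continuous_on S f" and g: "uniformly_continuous_on T g"
    and fg: "\<And>x. x \<in> S \<Longrightarrow> f x \<in> T \<and> g (f x) = x" "\<And>y. y \<in> T \<Longrightarrow> g y \<in> S \<and> f (g y) = y"
  obtains F G where "homeomorphism (closure S) (closure T) F G" "\<And>x. x \<in> S \<Longrightarrow> F x = f x"
proof -
  obtain F where F: "uniformly_continuous_on (closure S) F" "\<And>x. x \<in> S \<Longrightarrow> f x = F x"
    using uniformly_continuous_on_extension_on_closure[OF f] by metis
  obtain G where G: "uniformly_continuous_on (closure T) G" "\<And>x. x \<in> T \<Longrightarrow> g x = G x"
    using uniformly_continuous_on_extension_on_closure[OF g] by metis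
  have cF: "continuous_on (closure S) F" and cG: "continuous_on (closure T) G"
    using F G by (auto intro: uniformly_continuous_imp_continuous)
  have imF: "F ` closure S \<subseteq> closure T"
    by (rule image_closure_subset[OF cF closed_closure]) (use F fg in \<open>force simp: closure_subset[THEN subsetD]\<close>)
  have imG: "G ` closure T \<subseteq> closure S"
    by (rule image_closure_subset[OF cG closed_closure]) (use G fg in \<open>force simp: closure_subset[THEN subsetD]\<close>)
  have id1: "G (F x) = x" if "x \<in> closure S" for x
  proof -
    have "continuous_on (closure S) (\<lambda>x. dist (G (F x)) x)"
      by (intro continuous_intros continuous_on_compose2[OF cG cF imF])
    then have "dist (G (F x)) x = 0"
      by (rule continuous_constant_on_closure) (use that F G fg in force)+
    then show ?thesis by simp
  qed
  have id2: "F (G x) = x" if "x \<in> closure T" for x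
  proof -
    have "continuous_on (closure T) (\<lambda>x. dist (F (G x)) x)"
      by (intro continuous_intros continuous_on_compose2[OF cF cG imG])
    then have "dist (F (G x)) x = 0"
      by (rule continuous_constant_on_closure) (use that F G fg in force)+
    then show ?thesis by simp
  qed
  have "homeomorphism (closure S) (closure T) F G"
    by (rule homeomorphismI[OF cF cG imF imG]) (use id1 id2 in auto)
  then show ?thesis using that F by metis
qed

section \<open>The ellipse and its geometry\<close>

text \<open>For \<open>g = k h\<close> the harmonic map is \<open>stretch k\<close> after
  \<open>h\<close>. It scales the real axis by \<open>1 + k\<close> and the imaginary axis by
  \<open>1 - k\<close>.\<close>

definition stretch :: "real \<Rightarrow> complex \<Rightarrow> complex" where
  "stretch k w = w + of_real k * cnj w"

definition unstretch :: "real \<Rightarrow> complex \<Rightarrow> complex" where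
  "unstretch k w = (w - of_real k * cnj w) / of_real (1 - k\<^sup>2)"

text \<open>For \<open>0 < k < 1\<close> the semi-axes are \<open>1 / (1 + k)\<close> along the real
  and \<open>1 / (1 - k)\<close> along the imaginary axis.\<close>

definition ellipse :: "real \<Rightarrow> complex set" where
  "ellipse k = {w. norm (stretch k w) < 1}"

lemma linear_stretch: "linear (stretch k)"
  by (rule linearI) (simp_all add: stretch_def algebra_simps scaleR_conv_of_real)

lemmas stretch_linear_simps = linear_add[OF linear_stretch] linear_diff[OF linear_stretch]
  linear_0[OF linear_stretch] linear_neg[OF linear_stretch]

lemma stretch_of_real: "stretch k (of_real r * w) = of_real r * stretch k w"
  by (simp add: stretch_def algebra_simps)

lemma unstretch_diff: "unstretch k (v - w) = unstretch k v - unstretch k w"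
  unfolding unstretch_def diff_divide_distrib[symmetric] by (simp add: algebra_simps)

context
  fixes k :: real
  assumes k: "0 < k" "k < 1"
begin

lemma norm_stretch_le: "norm (stretch k w) \<le> (1 + k) * norm w"
  using norm_triangle_ineq[of w "of_real k * cnj w"] k by (simp add: stretch_def norm_mult algebra_simps)

lemma norm_stretch_ge: "(1 - k) * norm w \<le> norm (stretch k w)"
  using norm_diff_ineq[of w "of_real k * cnj w"] k by (simp add: stretch_def norm_mult algebra_simps)

lemma k_square: "1 - k\<^sup>2 > 0"
  using k by (simp add: power_less_one_iff)

lemma stretch_unstretch [simp]: "stretch k (unstretch k w) = w"
proof -
  have "stretch k (unstretch k w) = (w - of_real (k\<^sup>2) * w) / of_real (1 - k\<^sup>2)"
    unfolding stretch_def unstretch_def complex_cnj_divide times_divide_eq_right add_divide_distrib[symmetric]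
      complex_cnj_complex_of_real
    by (simp add: algebra_simps power2_eq_square)
  also have "\<dots> = of_real (1 - k\<^sup>2) * w / of_real (1 - k\<^sup>2)" by (simp add: algebra_simps)
  also have "\<dots> = w" using k_square by (intro nonzero_mult_div_cancel_left) (simp del: of_real_diff)
  finally show ?thesis .
qed

lemma unstretch_stretch [simp]: "unstretch k (stretch k w) = w"
proof -
  have "unstretch k (stretch k w) = of_real (1 - k\<^sup>2) * w / of_real (1 - k\<^sup>2)"
    unfolding stretch_def unstretch_def by (simp add: algebra_simps power2_eq_square)
  also have "\<dots> = w" using k_square by (intro nonzero_mult_div_cancel_left) (simp del: of_real_diff)
  finally show ?thesis .
qed

lemma norm_unstretch_le: "norm (unstretch k w) \<le> norm w / (1 - k)"
  using norm_stretch_ge[of "unstretch k w"] k by (simp add: field_simps)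

lemma stretch_continuous: "continuous_on S (stretch k)"
  unfolding stretch_def by (intro continuous_intros)

lemma ellipse_open: "open (ellipse k)"
  unfolding ellipse_def using stretch_continuous by (intro open_Collect_less continuous_intros) 

lemma ellipse_convex: "convex (ellipse k)"
proof -
  have "ellipse k = stretch k -` ball 0 1" by (auto simp: ellipse_def)
  then show ?thesis by (simp add: convex_linear_vimage linear_stretch)
qed

lemma zero_in_ellipse: "0 \<in> ellipse k"
  by (simp add: ellipse_def stretch_def)

lemma ellipse_not_UNIV: "ellipse k \<noteq> UNIV"
proof
  assume "ellipse k = UNIV"
  then have "unstretch k 1 \<in> ellipse k" by simp
  then show False by (simp add: ellipse_def)
qed

text \<open>The Riemann map is composed with a disc automorphism that moves the image of 0 back to
  0.\<close>

lemma ellipse_riemann_map: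
  obtains h \<psi> where "h holomorphic_on ball 0 1" "\<psi> holomorphic_on ellipse k" "h 0 = 0" "\<psi> 0 = 0"
    "\<And>z. z \<in> ball 0 1 \<Longrightarrow> h z \<in> ellipse k \<and> \<psi> (h z) = z"
    "\<And>w. w \<in> ellipse k \<Longrightarrow> \<psi> w \<in> ball 0 1 \<and> h (\<psi> w) = w"
proof -
  have "simply_connected (ellipse k)"
    using ellipse_convex convex_imp_simply_connected by blast
  then obtain f g where fg: "f holomorphic_on ellipse k" "g holomorphic_on ball 0 1"
      "\<forall>z\<in>ellipse k. f z \<in> ball 0 1 \<and> g (f z) = z"
      "\<forall>z\<in>ball 0 1. g z \<in> ellipse k \<and> f (g z) = z"
    using Riemann_mapping_theorem[of "ellipse k"] ellipse_open ellipse_not_UNIV zero_in_ellipse by auto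
  then have "f 0 \<in> ball 0 1" using zero_in_ellipse by blast
  then obtain a b where ab: "a (f 0) = 0" "a holomorphic_on ball 0 1" "a ` ball 0 1 \<subseteq> ball 0 1"
      "b holomorphic_on ball 0 1" "b ` ball 0 1 \<subseteq> ball 0 1"
      "\<And>z. z \<in> ball 0 1 \<Longrightarrow> a (b z) = z" "\<And>z. z \<in> ball 0 1 \<Longrightarrow> b (a z) = z"
    using ball_biholomorphism_exists by metis
  show ?thesis
  proof (rule that[of "g \<circ> b" "a \<circ> f"])
    show "g \<circ> b holomorphic_on ball 0 1"
      using ab fg by (intro holomorphic_on_compose_gen)
    show "a \<circ> f holomorphic_on ellipse k"
      using ab fg by (intro holomorphic_on_compose_gen) auto
    have "b 0 = f 0" using ab(1) ab(7)[OF \<open>f 0 \<in> ball 0 1\<close>] by simp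
    then show "(g \<circ> b) 0 = 0" using fg zero_in_ellipse by simp
    show "(a \<circ> f) 0 = 0" using ab by simp
    show "(g \<circ> b) z \<in> ellipse k \<and> (a \<circ> f) ((g \<circ> b) z) = z" if z: "z \<in> ball 0 1" for z
    proof -
      have "b z \<in> ball 0 1" using ab(5) z by blast
      then show ?thesis using fg(4) ab(6)[OF z] by simp
    qed
    show "(a \<circ> f) w \<in> ball 0 1 \<and> (g \<circ> b) ((a \<circ> f) w) = w" if w: "w \<in> ellipse k" for w
    proof -
      have "f w \<in> ball 0 1" using fg(3) w by blast
      then have "a (f w) \<in> ball 0 1" "b (a (f w)) = f w" using ab(3) ab(7) by blast+
      then show ?thesis using fg(3) w by simp
    qed
  qed
qed

text \<open>The half plane \<open>Re (\<beta> * v) < 1\<close> contains the ellipse and supports it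
  in the direction of \<open>w\<close>. Expressing the real-linear functional through multiplication
  by a complex \<open>\<beta>\<close> lets it be composed with holomorphic maps.\<close>

lemma ellipse_support:
  obtains n \<beta> :: complex where "norm n = 1" "stretch k w = of_real (norm (stretch k w)) * n"
    "1 - k \<le> norm \<beta>" "norm \<beta> \<le> 2" "\<And>v. Re (\<beta> * v) = Re (cnj n * stretch k v)"
proof -
  \<comment> \<open>If \<open>stretch k w = 0\<close>, every direction serves and 1 is the
    default.\<close>
  define n where "n = (if stretch k w = 0 then 1 else sgn (stretch k w))"
  define \<beta> where "\<beta> = cnj n + of_real k * n"
  have n: "norm n = 1" by (simp add: n_def norm_sgn)
  have "stretch k w = of_real (norm (stretch k w)) * n"
    by (simp add: n_def sgn_eq)
  moreover have "\<beta> = stretch k (cnj n)" by (simp add: \<beta>_def stretch_def)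
  then have "1 - k \<le> norm \<beta>" "norm \<beta> \<le> 2"
    using norm_stretch_ge[of "cnj n"] norm_stretch_le[of "cnj n"] n k by auto
  moreover have "Re (\<beta> * v) = Re (cnj n * stretch k v)" for v
    by (simp add: \<beta>_def stretch_def algebra_simps)
  ultimately show ?thesis using that n by blast
qed

text \<open>Prepares Harnack's inequality at \<open>w\<close>: seen from \<open>w0\<close>, the
  relative distance of \<open>w\<close> to the edge of the larger ball is comparable to
  \<open>1 - norm (stretch k w)\<close>, uniformly in \<open>w\<close>, while the centres stay away
  from the boundary.\<close>

lemma interior_ball:
  assumes w: "w \<in> ellipse k" "norm (stretch k w) \<ge> 1/2"
  obtains w0 r where "r > 0" "norm (w - w0) = r" "(norm (stretch k w0))\<^sup>2 \<le> 1 - (1 - k)\<^sup>2 / 16"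
    "ball w0 (r * (2 - norm (stretch k w))) \<subseteq> ellipse k"
proof -
  define s where "s = norm (stretch k w)"
  have s: "1/2 \<le> s" "s < 1" using w by (auto simp: s_def ellipse_def)
  obtain n \<beta> :: complex where n: "norm n = 1" "stretch k w = of_real s * n"
    "1 - k \<le> norm \<beta>" "norm \<beta> \<le> 2" "\<And>v. Re (\<beta> * v) = Re (cnj n * stretch k v)"
    unfolding s_def using ellipse_support by metis
  \<comment> \<open>The outward unit normal at \<open>w\<close> to the level curve of
    \<open>norm (stretch k _)\<close>.\<close>
  define m where "m = cnj (sgn \<beta>)"
  have \<beta>: "\<beta> \<noteq> 0" using n k by auto
  have m: "norm m = 1" using \<beta> by (simp add: m_def norm_sgn)
  have \<beta>m: "\<beta> = of_real (norm \<beta>) * cnj m" using \<beta> by (simp add: m_def sgn_eq)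
  \<comment> \<open>Chosen so that \<open>4 * r \<le> s * norm \<beta>\<close>, by
    \<open>s \<ge> 1/2\<close> and \<open>norm \<beta> \<ge> 1 - k\<close>.\<close>
  define r where "r = (1 - k) / 8"
  have r: "0 < r" "r \<le> 1/8" using k by (auto simp: r_def)
  \<comment> \<open>Expanding around \<open>w\<close> with \<open>d = u - m\<close>, the linear term
    contains a negative multiple of \<open>(norm d)\<^sup>2\<close>, which absorbs the quadratic
    term by the choice of \<open>r\<close>.\<close>
  have key: "(norm (stretch k (w - of_real r * m + of_real r * u)))\<^sup>2
      \<le> s\<^sup>2 + r * s * norm \<beta> * ((norm u)\<^sup>2 - 1)" for u
  proof -
    define d where "d = u - m"
    have d2: "(norm d)\<^sup>2 = (norm u)\<^sup>2 + 1 - 2 * Re (cnj m * u)"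
    proof -
      have "(norm d)\<^sup>2 = (norm u)\<^sup>2 + (norm m)\<^sup>2 - 2 * Re (cnj m * u)"
        unfolding d_def cmod_power2 by (simp add: power2_eq_square algebra_simps)
      then show ?thesis using m by simp
    qed
    have mm: "Re (cnj m * m) = 1"
      using m by (simp add: complex_norm_square[symmetric] mult.commute)
    have "Re (\<beta> * d) = norm \<beta> * Re (cnj m * d)"
      by (subst \<beta>m) (simp add: mult.assoc del: complex_cnj_cancel_iff)
    also have "Re (cnj m * d) = Re (cnj m * u) - 1" using mm by (simp add: d_def right_diff_distrib)
    finally have \<beta>d: "Re (\<beta> * d) = norm \<beta> * (((norm u)\<^sup>2 - 1 - (norm d)\<^sup>2) / 2)"
      using d2 by simp
    have "stretch k (w - of_real r * m + of_real r * u) = of_real s * n + of_real r * stretch k d"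
      by (simp add: d_def stretch_linear_simps stretch_of_real n(2) right_diff_distrib)
    moreover have "(norm (of_real s * n + of_real r * a))\<^sup>2
        = s\<^sup>2 * (norm n)\<^sup>2 + 2 * s * r * Re (cnj n * a) + r\<^sup>2 * (norm a)\<^sup>2" for a
      unfolding cmod_power2 by (simp add: power2_eq_square algebra_simps)
    ultimately have "(norm (stretch k (w - of_real r * m + of_real r * u)))\<^sup>2
        = s\<^sup>2 + 2 * s * r * Re (\<beta> * d) + r\<^sup>2 * (norm (stretch k d))\<^sup>2"
      using n by simp
    also have "\<dots> \<le> s\<^sup>2 + 2 * s * r * Re (\<beta> * d) + r\<^sup>2 * (2 * norm d)\<^sup>2"
    proof -
      have "norm (stretch k d) \<le> 2 * norm d"
        using norm_stretch_le[of d] mult_right_mono[of "1+k" 2 "norm d"] k by simp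
      then have "(norm (stretch k d))\<^sup>2 \<le> (2 * norm d)\<^sup>2" by (intro power_mono) auto
      then show ?thesis using mult_left_mono[of _ _ "r\<^sup>2"] by simp
    qed
    also have "\<dots> = s\<^sup>2 + r * s * norm \<beta> * ((norm u)\<^sup>2 - 1) - r * (s * norm \<beta> - 4 * r) * (norm d)\<^sup>2"
      unfolding \<beta>d by (simp add: field_simps power2_eq_square)
    also have "\<dots> \<le> s\<^sup>2 + r * s * norm \<beta> * ((norm u)\<^sup>2 - 1)"
    proof -
      have "1/2 * (1 - k) \<le> s * norm \<beta>" using s n k by (intro mult_mono) auto
      then have "4 * r \<le> s * norm \<beta>" by (simp add: r_def)
      then show ?thesis using r by simp
    qed
    finally show ?thesis .
  qed
  define w0 where "w0 = w - of_real r * m"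
  have n0: "norm (w - w0) = r" using m r by (simp add: w0_def norm_mult)
  have c0: "(norm (stretch k w0))\<^sup>2 \<le> 1 - (1 - k)\<^sup>2 / 16"
  proof -
    have "(1 - k) / 8 * (1/2 * (1 - k)) \<le> r * (s * norm \<beta>)"
      using s n k r by (intro mult_mono) (auto simp: r_def)
    moreover have "s\<^sup>2 \<le> 1" using s by (simp add: power_le_one)
    ultimately show ?thesis using key[of 0] by (simp add: w0_def power2_eq_square)
  qed
  have "ball w0 (r * (2 - s)) \<subseteq> ellipse k"
  proof
    fix v assume v: "v \<in> ball w0 (r * (2 - s))"
    define u where "u = (v - w0) / of_real r"
    have vu: "v = w - of_real r * m + of_real r * u" using r by (simp add: u_def w0_def)
    have "norm u < 2 - s"
      using v r by (simp add: u_def norm_divide dist_norm norm_minus_commute divide_simps mult.commute)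
    then have "(norm u)\<^sup>2 \<le> (2 - s)\<^sup>2" by (intro power_mono) auto
    then have "r * s * norm \<beta> * ((norm u)\<^sup>2 - 1) \<le> r * s * norm \<beta> * ((2 - s)\<^sup>2 - 1)"
      using r s by (intro mult_left_mono) auto
    \<comment> \<open>This bound equals \<open>(1 - s) * (3 - s) / 4\<close>, which is below
      \<open>(1 - s) * (1 + s)\<close>.\<close>
    also have "\<dots> \<le> 1/8 * 1 * 2 * ((2 - s)\<^sup>2 - 1)"
    proof (intro mult_mono mult_right_mono)
      show "0 \<le> (2 - s)\<^sup>2 - 1" using s power_mono[of 1 "2 - s" 2] by simp
    qed (use r s n in auto)
    also have "\<dots> < 1 - s\<^sup>2"
    proof -
      have "(1 - s) * (3 - s) < (1 - s) * (4 * (1 + s))" using s by (intro mult_strict_left_mono) auto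
      then show ?thesis by (simp add: power2_eq_square algebra_simps)
    qed
    finally have "(norm (stretch k v))\<^sup>2 < 1" using key[of u] by (simp add: vu)
    then show "v \<in> ellipse k" by (simp add: ellipse_def power_less_one_iff)
  qed
  then show ?thesis using that[of r w0] r n0 c0 by (simp add: s_def)
qed

end

section \<open>Boundary behaviour of the conformal map and its inverse\<close>

locale ellipse_map =
  fixes k :: real and h \<psi> :: "complex \<Rightarrow> complex"
  assumes k: "0 < k" "k < 1"
    and h_hol: "h holomorphic_on ball 0 1" and \<psi>_hol: "\<psi> holomorphic_on ellipse k"
    and h_zero: "h 0 = 0"
    and h_mem: "norm z < 1 \<Longrightarrow> h z \<in> ellipse k" and \<psi>_h: "norm z < 1 \<Longrightarrow> \<psi> (h z) = z"
    and \<psi>_mem: "w \<in> ellipse k \<Longrightarrow> norm (\<psi> w) < 1" and h_\<psi>: "w \<in> ellipse k \<Longrightarrow> h (\<psi> w) = w"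
begin

lemma \<psi>_zero: "\<psi> 0 = 0"
  using \<psi>_h[of 0] h_zero by simp

text \<open>Turns the supporting half plane at \<open>h z\<close> into a holomorphic function
  \<open>1 - \<beta> * h\<close> to which the half plane estimates apply.\<close>

lemma support_function:
  assumes z: "norm z < 1"
  obtains \<beta> where "1 - k \<le> norm \<beta>" "\<And>u. norm u < 1 \<Longrightarrow> Re (1 - \<beta> * h u) > 0"
    "Re (1 - \<beta> * h z) = 1 - norm (stretch k (h z))"
proof -
  obtain n \<beta> :: complex where n: "norm n = 1"
      "stretch k (h z) = of_real (norm (stretch k (h z))) * n" "1 - k \<le> norm \<beta>"
      "\<And>v. Re (\<beta> * v) = Re (cnj n * stretch k v)"
    using ellipse_support[OF k, of "h z"] by metis
  have "Re (1 - \<beta> * h u) > 0" if "norm u < 1" for u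
  proof -
    have "Re (cnj n * stretch k (h u)) \<le> norm (stretch k (h u))"
      using complex_Re_le_cmod[of "cnj n * stretch k (h u)"] n(1) by (simp add: norm_mult)
    also have "\<dots> < 1" using h_mem[OF that] by (simp add: ellipse_def)
    finally show ?thesis using n(4)[of "h u"] by simp
  qed
  moreover have "Re (1 - \<beta> * h z) = 1 - norm (stretch k (h z))"
  proof -
    have "cnj n * n = 1" using n(1) by (simp add: complex_norm_square[symmetric] mult.commute)
    then have "cnj n * stretch k (h z) = of_real (norm (stretch k (h z)))"
      by (subst n(2)) (simp add: mult.left_commute)
    then show ?thesis using n(4)[of "h z"] by (simp del: times_complex.sel)
  qed
  ultimately show ?thesis using that n(3) by blast
qed

text \<open>Harnack's inequality for the support function from the centre, where its value is
  1.\<close>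

lemma one_minus_norm_le:
  assumes z: "norm z < 1"
  shows "(1 - norm z) / 2 \<le> 1 - norm (stretch k (h z))"
proof -
  obtain \<beta> where \<beta>: "\<And>u. norm u < 1 \<Longrightarrow> Re (1 - \<beta> * h u) > 0"
      "Re (1 - \<beta> * h z) = 1 - norm (stretch k (h z))"
    using support_function[OF z] by metis
  have "(1 - norm z) / 2 \<le> (1 - norm z) / (1 + norm z)" using z by (intro divide_left_mono mult_pos_pos add_pos_nonneg) auto
  also have "\<dots> \<le> 1 - norm (stretch k (h z))"
  proof -
    have "(1 - norm (z - 0)) / (1 + norm (z - 0)) * Re (1 - \<beta> * h 0) \<le> Re (1 - \<beta> * h z)"
      by (rule halfplane_harnack) (use z \<beta>(1) in \<open>auto intro!: holomorphic_intros h_hol simp del: minus_complex.sel times_complex.sel\<close>)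
    then show ?thesis unfolding \<beta>(2) by (simp add: h_zero)
  qed
  finally show ?thesis .
qed

text \<open>The Schwarz estimate for the support function on the largest disc around
  \<open>z\<close>. It becomes a uniform bound once \<open>one_minus_norm_ge\<close> controls the
  quotient.\<close>

lemma norm_deriv_h_le:
  assumes z: "norm z < 1"
  shows "norm (deriv h z) \<le> 2 * (1 - norm (stretch k (h z))) / ((1 - k) * (1 - norm z))"
proof -
  obtain \<beta> where \<beta>: "1 - k \<le> norm \<beta>" "\<And>u. norm u < 1 \<Longrightarrow> Re (1 - \<beta> * h u) > 0"
      "Re (1 - \<beta> * h z) = 1 - norm (stretch k (h z))"
    using support_function[OF z] by metis
  have sub: "ball z (1 - norm z) \<subseteq> ball 0 1"
    by (simp add: ball_subset_ball_iff dist_norm)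
  have "(h has_field_derivative deriv h z) (at z)"
    using h_hol z by (intro holomorphic_derivI[of _ "ball 0 1"]) auto
  then have "((\<lambda>u. 1 - \<beta> * h u) has_field_derivative (- \<beta> * deriv h z)) (at z)"
    by (auto intro!: derivative_eq_intros)
  then have "deriv (\<lambda>u. 1 - \<beta> * h u) z = - \<beta> * deriv h z" by (rule DERIV_imp_deriv)
  moreover have "norm (deriv (\<lambda>u. 1 - \<beta> * h u) z) \<le> 2 * Re (1 - \<beta> * h z) / (1 - norm z)"
  proof (rule halfplane_schwarz(1))
    show "(\<lambda>u. 1 - \<beta> * h u) holomorphic_on ball z (1 - norm z)"
      by (intro holomorphic_intros holomorphic_on_subset[OF h_hol sub])
    show "0 < Re (1 - \<beta> * h u)" if "u \<in> ball z (1 - norm z)" for u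
      using \<beta>(2) sub that by (meson mem_ball_0 subsetD)
  qed (use z in auto)
  ultimately have "norm \<beta> * norm (deriv h z) \<le> 2 * (1 - norm (stretch k (h z))) / (1 - norm z)"
    unfolding \<beta>(3) by (simp add: norm_mult)
  then have "(1 - k) * norm (deriv h z) \<le> 2 * (1 - norm (stretch k (h z))) / (1 - norm z)"
    using mult_right_mono[OF \<beta>(1), of "norm (deriv h z)"] by simp
  then have "norm (deriv h z) \<le> 2 * (1 - norm (stretch k (h z))) / (1 - norm z) / (1 - k)"
    using k by (subst pos_le_divide_eq) (simp_all add: mult.commute)
  then show ?thesis by (simp add: mult.commute)
qed

text \<open>As \<open>stretch k\<close> at most doubles lengths, the ball of radius
  \<open>\<delta> / 2\<close> lies in the ellipse. The disc estimate there, with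
  \<open>1 - norm (\<psi> w) \<le> 2 * \<delta>\<close> from \<open>one_minus_norm_le\<close>,
  yields 8.\<close>

lemma norm_deriv_\<psi>_le:
  assumes w: "w \<in> ellipse k"
  shows "norm (deriv \<psi> w) \<le> 8"
proof -
  define \<delta> where "\<delta> = 1 - norm (stretch k w)"
  have \<delta>: "\<delta> > 0" using w by (simp add: \<delta>_def ellipse_def)
  have sub: "ball w (\<delta> / 2) \<subseteq> ellipse k"
  proof
    fix v assume v: "v \<in> ball w (\<delta> / 2)"
    have "norm (stretch k v) \<le> norm (stretch k w) + norm (stretch k (v - w))"
      using norm_triangle_ineq[of "stretch k w" "stretch k (v - w)"]
      by (simp add: stretch_linear_simps)
    also have "norm (stretch k (v - w)) \<le> 2 * norm (v - w)"
      using norm_stretch_le[OF k, of "v - w"] mult_right_mono[of "1 + k" 2 "norm (v - w)"] k by simp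
    also have "norm (stretch k w) + 2 * norm (v - w) < 1"
      using v by (simp add: \<delta>_def dist_norm norm_minus_commute)
    finally show "v \<in> ellipse k" by (simp add: ellipse_def)
  qed
  have "norm (deriv \<psi> w) \<le> 2 * (1 - norm (\<psi> w)) / (\<delta> / 2)"
    by (rule disc_valued_bounds(1)) (use \<psi>_hol \<psi>_mem sub \<delta> in \<open>auto intro: holomorphic_on_subset\<close>)
  also have "\<dots> \<le> 8"
    using one_minus_norm_le[OF \<psi>_mem[OF w]] \<delta> by (simp add: h_\<psi> w \<delta>_def[symmetric] field_simps)
  finally show ?thesis .
qed

text \<open>Near the boundary, Harnack's inequality in the interior ball transports the bound
  \<open>norm (\<psi> w0) \<le> M < 1\<close> from its centre to \<open>w\<close> with factor
  \<open>\<delta> / (2 + \<delta>) \<ge> \<delta> / 3\<close>. The remaining points satisfy the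
  bound by \<open>M\<close> directly.\<close>

lemma one_minus_norm_ge:
  obtains C where "C > 0"
    "\<And>z. norm z < 1 \<Longrightarrow> 1 - norm (stretch k (h z)) \<le> C * (1 - norm z)"
proof -
  define \<kappa> where "\<kappa> = (1 - k)\<^sup>2 / 16"
  \<comment> \<open>The level is the one that \<open>interior_ball\<close> guarantees for its
    centres; this set is compact inside the ellipse.\<close>
  define K where "K = {w. (norm (stretch k w))\<^sup>2 \<le> 1 - \<kappa>}"
  have \<kappa>: "0 < \<kappa>" "\<kappa> \<le> 1/16" using k by (auto simp: \<kappa>_def power_le_one)
  have KE: "K \<subseteq> ellipse k"
    using \<kappa> by (force simp: K_def ellipse_def intro: power2_less_imp_less)
  have "bounded K"
  proof (rule boundedI)
    fix w assume "w \<in> K"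
    then have "norm (stretch k w) < 1" using KE by (auto simp: ellipse_def)
    then show "norm w \<le> 1 / (1 - k)"
      using norm_unstretch_le[OF k, of "stretch k w"] k divide_right_mono[of "norm (stretch k w)" 1 "1 - k"]
      by (simp add: unstretch_stretch[OF k])
  qed
  moreover have "closed K" unfolding K_def
    by (intro closed_Collect_le continuous_intros stretch_continuous[OF k])
  ultimately have "compact K" by (simp add: compact_eq_bounded_closed)
  moreover have "0 \<in> K" using \<kappa> by (simp add: K_def stretch_def)
  moreover have "continuous_on K (\<lambda>w. norm (\<psi> w))"
    using holomorphic_on_imp_continuous_on[OF \<psi>_hol] KE by (intro continuous_intros) (rule continuous_on_subset)
  ultimately obtain wM where wM: "wM \<in> K" "\<And>w. w \<in> K \<Longrightarrow> norm (\<psi> w) \<le> norm (\<psi> wM)"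
    using continuous_attains_sup[of K "\<lambda>w. norm (\<psi> w)"] by auto
  define M where "M = norm (\<psi> wM)"
  have M: "0 \<le> M" "M < 1" using \<psi>_mem wM KE by (auto simp: M_def)
  have "1 - norm (stretch k w) \<le> 3 / (1 - M) * (1 - norm (\<psi> w))" if w: "w \<in> ellipse k" for w
  proof -
    define \<delta> where "\<delta> = 1 - norm (stretch k w)"
    have \<delta>: "0 < \<delta>" "\<delta> \<le> 1" using w by (auto simp: \<delta>_def ellipse_def)
    have "\<delta> / 3 * (1 - M) \<le> 1 - norm (\<psi> w)"
    proof (cases "norm (stretch k w) \<ge> 1/2")
      case True
      have "2 - norm (stretch k w) = 1 + \<delta>" by (simp add: \<delta>_def)
      then obtain w0 r where r: "r > 0" "norm (w - w0) = r" "w0 \<in> K" "ball w0 (r * (1 + \<delta>)) \<subseteq> ellipse k"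
        using interior_ball[OF k w True] unfolding K_def \<kappa>_def by (metis (no_types, lifting) mem_Collect_eq)
      have wb: "w \<in> ball w0 (r * (1 + \<delta>))"
        using r \<delta> by (simp add: dist_norm norm_minus_commute)
      have "\<delta> / 3 * (1 - M) \<le> \<delta> / (2 + \<delta>) * (1 - norm (\<psi> w0))"
        using \<delta> M wM(2)[OF r(3)] by (intro mult_mono divide_left_mono) (auto simp: M_def)
      also have "\<delta> / (2 + \<delta>) = (r * (1 + \<delta>) - norm (w - w0)) / (r * (1 + \<delta>) + norm (w - w0))"
      proof -
        have "(r * (1 + \<delta>) - r) / (r * (1 + \<delta>) + r) = (r * \<delta>) / (r * (2 + \<delta>))"
          by (simp add: algebra_simps)
        then show ?thesis using r by simp
      qed
      also have "\<dots> * (1 - norm (\<psi> w0)) \<le> 1 - norm (\<psi> w)"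
        by (rule disc_valued_bounds(2)[OF _ _ wb])
          (use \<psi>_hol \<psi>_mem r in \<open>auto intro: holomorphic_on_subset\<close>)
      finally show ?thesis .
    next
      case False
      then have "(norm (stretch k w))\<^sup>2 \<le> (1/2)\<^sup>2" by (intro power_mono) auto
      then have "w \<in> K" using \<kappa> by (simp add: K_def power2_eq_square)
      then have "1 - M \<le> 1 - norm (\<psi> w)" using wM(2) by (simp add: M_def)
      moreover have "\<delta> / 3 * (1 - M) \<le> 1 * (1 - M)" using \<delta> M by (intro mult_right_mono) auto
      ultimately show ?thesis by simp
    qed
    then show ?thesis using M by (simp add: \<delta>_def[symmetric] field_simps)
  qed
  then have "1 - norm (stretch k (h z)) \<le> 3 / (1 - M) * (1 - norm z)" if "norm z < 1" for z
    using h_mem[OF that] \<psi>_h[OF that] by metis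
  moreover have "3 / (1 - M) > 0" using M by simp
  ultimately show ?thesis using that by blast
qed

text \<open>The factor \<open>1 - norm z\<close> cancels between \<open>norm_deriv_h_le\<close> and
  \<open>one_minus_norm_ge\<close>, so \<open>deriv h\<close> is bounded and \<open>h\<close> is
  Lipschitz on the convex disc.\<close>

lemma stretch_h_uniformly_continuous: "uniformly_continuous_on (ball 0 1) (\<lambda>z. stretch k (h z))"
proof -
  obtain C where C: "C > 0" "\<And>z. norm z < 1 \<Longrightarrow> 1 - norm (stretch k (h z)) \<le> C * (1 - norm z)"
    using one_minus_norm_ge by blast
  have bd: "norm (deriv h z) \<le> 2 * C / (1 - k)" if "z \<in> ball 0 1" for z
  proof -
    have z: "norm z < 1" using that by simp
    have "norm (deriv h z) \<le> 2 * (1 - norm (stretch k (h z))) / ((1 - k) * (1 - norm z))"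
      by (rule norm_deriv_h_le[OF z])
    also have "\<dots> \<le> 2 * (C * (1 - norm z)) / ((1 - k) * (1 - norm z))"
      using C(2)[OF z] z k by (intro divide_right_mono) auto
    also have "\<dots> = 2 * C / (1 - k)" using z by simp
    finally show ?thesis .
  qed
  have lip: "norm (h x - h y) \<le> 2 * C / (1 - k) * norm (x - y)" if "x \<in> ball 0 1" "y \<in> ball 0 1" for x y
    by (rule field_differentiable_bound[of "ball 0 1" h "deriv h"])
      (use that bd h_hol in \<open>auto intro: holomorphic_derivI\<close>)
  have "norm (stretch k (h x) - stretch k (h y)) \<le> (2 * (2 * C / (1 - k))) * norm (x - y)"
    if "x \<in> ball 0 1" "y \<in> ball 0 1" for x y
  proof -
    have "norm (stretch k (h x) - stretch k (h y)) \<le> 2 * norm (h x - h y)"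
      using norm_stretch_le[OF k, of "h x - h y"] mult_right_mono[of "1 + k" 2 "norm (h x - h y)"] k
      by (simp add: stretch_linear_simps)
    then show ?thesis using lip[OF that] by simp
  qed
  then have "(2 * (2 * C / (1 - k)))-lipschitz_on (ball 0 1) (\<lambda>z. stretch k (h z))"
    using C k by (intro lipschitz_onI) (auto simp: dist_norm)
  then show ?thesis by (rule lipschitz_on_uniformly_continuous)
qed

lemma \<psi>_unstretch_uniformly_continuous: "uniformly_continuous_on (ball 0 1) (\<lambda>z. \<psi> (unstretch k z))"
proof -
  have lip: "norm (\<psi> x - \<psi> y) \<le> 8 * norm (x - y)" if "x \<in> ellipse k" "y \<in> ellipse k" for x y
    by (rule field_differentiable_bound[of "ellipse k" \<psi> "deriv \<psi>"])
      (use that norm_deriv_\<psi>_le \<psi>_hol ellipse_convex[OF k] ellipse_open[OF k]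
        in \<open>auto intro: holomorphic_derivI has_field_derivative_at_within\<close>)
  have mem: "unstretch k z \<in> ellipse k" if "z \<in> ball 0 1" for z
    using that by (simp add: ellipse_def stretch_unstretch[OF k])
  have "norm (\<psi> (unstretch k x) - \<psi> (unstretch k y)) \<le> (8 / (1 - k)) * norm (x - y)"
    if "x \<in> ball 0 1" "y \<in> ball 0 1" for x y
    using lip[OF mem[OF that(1)] mem[OF that(2)]] norm_unstretch_le[OF k, of "x - y"]
    by (simp add: unstretch_diff)
  then have "(8 / (1 - k))-lipschitz_on (ball 0 1) (\<lambda>z. \<psi> (unstretch k z))"
    using k by (intro lipschitz_onI) (auto simp: dist_norm)
  then show ?thesis by (rule lipschitz_on_uniformly_continuous)
qed

section \<open>Symmetry and the derivative at the centre\<close>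

lemma deriv_\<psi>_h: "norm z < 1 \<Longrightarrow> deriv \<psi> (h z) * deriv h z = 1"
proof -
  assume z: "norm z < 1"
  have "(h has_field_derivative deriv h z) (at z)"
    using h_hol z by (intro holomorphic_derivI[of _ "ball 0 1"]) auto
  moreover have "(\<psi> has_field_derivative deriv \<psi> (h z)) (at (h z))"
    using \<psi>_hol h_mem[OF z] ellipse_open[OF k] by (intro holomorphic_derivI[of _ "ellipse k"]) auto
  ultimately have "((\<lambda>z. \<psi> (h z)) has_field_derivative (deriv \<psi> (h z) * deriv h z)) (at z)"
    by (rule DERIV_chain2[rotated])
  moreover have "((\<lambda>z. \<psi> (h z)) has_field_derivative 1) (at z)"
    by (rule has_field_derivative_transform_within_open[of "\<lambda>z. z" _ _ "ball 0 1"])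
      (use z in \<open>auto simp: \<psi>_h\<close>)
  ultimately show ?thesis by (rule DERIV_unique)
qed

text \<open>The ellipse is symmetric about 0, so \<open>\<sigma>\<close> is an involution of the
  disc fixing 0. Equality in the Schwarz lemma makes it a rotation, and the chain rule at 0 gives
  the factor -1.\<close>

lemma h_odd:
  assumes z: "norm z < 1"
  shows "h (- z) = - h z"
proof -
  define \<sigma> where "\<sigma> z = \<psi> (- h z)" for z
  have neg: "- w \<in> ellipse k" if "w \<in> ellipse k" for w
    using that by (simp add: ellipse_def stretch_linear_simps)
  have "- h z \<in> ellipse k" if "z \<in> ball 0 1" for z using that neg h_mem by simp
  then have \<sigma>_hol: "\<sigma> holomorphic_on ball 0 1" unfolding \<sigma>_def
    by (intro holomorphic_on_compose_gen[OF _ \<psi>_hol, unfolded o_def] holomorphic_intros h_hol) auto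
  have \<sigma>_0: "\<sigma> 0 = 0" by (simp add: \<sigma>_def h_zero \<psi>_zero)
  have \<sigma>_lt: "norm (\<sigma> z) < 1" if "norm z < 1" for z
    unfolding \<sigma>_def by (intro \<psi>_mem neg h_mem that)
  have \<sigma>\<sigma>: "\<sigma> (\<sigma> z) = z" if "norm z < 1" for z
    using h_\<psi>[OF neg[OF h_mem[OF that]]] \<psi>_h[OF that] by (simp add: \<sigma>_def)
  note S = Schwarz_Lemma[OF \<sigma>_hol \<sigma>_0 \<sigma>_lt]
  \<comment> \<open>Applying Schwarz to both steps of \<open>\<sigma> (\<sigma> _)\<close> leaves no
    room for contraction; 1/2 stands for any nonzero point of the disc.\<close>
  have "norm (\<sigma> (1/2)) = norm (1/2 :: complex)"
  proof (rule antisym)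
    show "norm (\<sigma> (1/2)) \<le> norm (1/2 :: complex)" by (rule S(1)) auto
    have "norm (\<sigma> (\<sigma> (1/2))) \<le> norm (\<sigma> (1/2))" by (intro S(1) \<sigma>_lt) auto
    then show "norm (1/2 :: complex) \<le> norm (\<sigma> (1/2))" by (simp add: \<sigma>\<sigma>)
  qed
  then have "\<exists>z. norm z < 1 \<and> z \<noteq> 0 \<and> norm (\<sigma> z) = norm z" by (intro exI[of _ "1/2"]) auto
  then obtain \<alpha> where \<alpha>: "\<And>z. norm z < 1 \<Longrightarrow> \<sigma> z = \<alpha> * z" using S(3)[of 0] by auto
  have "(h has_field_derivative deriv h 0) (at 0)"
    using h_hol by (intro holomorphic_derivI[of _ "ball 0 1"]) auto
  then have "((\<lambda>z. - h z) has_field_derivative (- deriv h 0)) (at 0)" by (rule DERIV_minus)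
  moreover have "(\<psi> has_field_derivative deriv \<psi> 0) (at (- h 0))"
    using \<psi>_hol zero_in_ellipse[OF k] ellipse_open[OF k] h_zero
    by (auto intro: holomorphic_derivI[of _ "ellipse k"])
  ultimately have "(\<sigma> has_field_derivative (deriv \<psi> 0 * (- deriv h 0))) (at 0)"
    unfolding \<sigma>_def by (rule DERIV_chain2[rotated])
  moreover have "(\<sigma> has_field_derivative \<alpha>) (at 0)"
    by (rule has_field_derivative_transform_within_open[of "\<lambda>z. \<alpha> * z" _ _ "ball 0 1"])
      (auto simp: \<alpha> intro!: derivative_eq_intros)
  ultimately have "\<alpha> = deriv \<psi> 0 * (- deriv h 0)" by (rule DERIV_unique[rotated])
  then have "\<alpha> = - 1" using deriv_\<psi>_h[of 0] by (simp add: h_zero)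
  then have "\<psi> (- h z) = - z" using \<alpha>[OF z] by (simp add: \<sigma>_def)
  then show ?thesis using h_\<psi>[OF neg[OF h_mem[OF z]]] by simp
qed

text \<open>The ellipse lies in the strip \<open>\<bar>Re w\<bar> < 1 / (1 + k)\<close>, which the
  exponential in \<open>q\<close> carries to the right half plane with 0 going to 1. The Schwarz
  estimate then bounds \<open>deriv q 0\<close> by 2.\<close>

lemma norm_deriv_h_zero_le: "norm (deriv h 0) \<le> 4 / (pi * (1 + k))"
proof -
  define q where "q z = exp (\<i> * of_real (pi * (1 + k) / 2) * h z)" for z
  have pos: "Re (q z) > 0" if "z \<in> ball 0 1" for z
  proof -
    have "\<bar>Re (stretch k (h z))\<bar> < 1"
      using abs_Re_le_cmod[of "stretch k (h z)"] h_mem[of z] that by (simp add: ellipse_def)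
    then have "\<bar>(1 + k) * Re (h z)\<bar> < 1" by (simp add: stretch_def algebra_simps)
    then have "pi / 2 * \<bar>(1 + k) * Re (h z)\<bar> < pi / 2 * 1" by (intro mult_strict_left_mono) auto
    then have "\<bar>pi * (1 + k) / 2 * Re (h z)\<bar> < pi / 2" by (simp add: abs_mult mult.assoc)
    then have "cos (pi * (1 + k) / 2 * Re (h z)) > 0" by (intro cos_gt_zero_pi) linarith+
    then show ?thesis by (simp add: q_def Re_exp)
  qed
  have hol: "q holomorphic_on ball 0 1" unfolding q_def by (intro holomorphic_intros h_hol)
  have q0: "q 0 = 1" by (simp add: q_def h_zero)
  have dh: "(h has_field_derivative deriv h 0) (at 0)"
    using h_hol by (intro holomorphic_derivI[of _ "ball 0 1"]) auto
  have "(q has_field_derivative (\<i> * of_real (pi * (1 + k) / 2) * deriv h 0)) (at 0)"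
    unfolding q_def by (rule derivative_eq_intros dh refl)+ (simp add: h_zero)
  then have "deriv q 0 = \<i> * of_real (pi * (1 + k) / 2) * deriv h 0" by (rule DERIV_imp_deriv)
  moreover have "norm (deriv q 0) \<le> 2"
    using halfplane_schwarz(1)[OF hol _ pos] q0 by simp
  ultimately have "pi * (1 + k) / 2 * norm (deriv h 0) \<le> 2"
    using k by (simp add: norm_mult del: of_real_mult of_real_add of_real_divide)
  then show ?thesis using k by (subst pos_le_divide_eq) (simp_all add: algebra_simps add_pos_pos)
qed

section \<open>Admissibility of the examples and the limit k to 1\<close>

lemma harm_eq: "harm h (\<lambda>z. of_real k * h z) z = stretch k (h z)"
  by (simp add: harm_def stretch_def)

lemma odd_admissible: "odd_admissible h (\<lambda>z. of_real k * h z)"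
proof -
  let ?f = "harm h (\<lambda>z. of_real k * h z)"
  have inv1: "stretch k (h z) \<in> ball 0 1 \<and> \<psi> (unstretch k (stretch k (h z))) = z"
    if "z \<in> ball 0 1" for z
    using that h_mem[of z] \<psi>_h[of z] by (simp add: unstretch_stretch[OF k] ellipse_def)
  have inv2: "\<psi> (unstretch k z) \<in> ball 0 1 \<and> stretch k (h (\<psi> (unstretch k z))) = z"
    if "z \<in> ball 0 1" for z
  proof -
    have "unstretch k z \<in> ellipse k" using that by (simp add: ellipse_def stretch_unstretch[OF k])
    then show ?thesis using \<psi>_mem h_\<psi> by (simp add: stretch_unstretch[OF k])
  qed
  obtain F F' where F: "homeomorphism (closure (ball 0 1)) (closure (ball 0 1)) F F'"
      "\<And>z. z \<in> ball 0 1 \<Longrightarrow> F z = stretch k (h z)"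
    using uniformly_continuous_inverse_extends[OF stretch_h_uniformly_continuous
      \<psi>_unstretch_uniformly_continuous inv1 inv2] by blast
  have cF: "continuous_on (closure (ball 0 1)) F" using F(1) by (rule homeomorphism_cont1)
  have "bij_betw ?f (ball 0 1) (ball 0 1)"
    by (rule bij_betw_byWitness[where f' = "\<lambda>z. \<psi> (unstretch k z)"])
      (use inv1 inv2 in \<open>auto simp: harm_eq\<close>)
  moreover have "norm (deriv (\<lambda>z. of_real k * h z) z) < norm (deriv h z)" if "z \<in> ball 0 1" for z
  proof -
    have "(h has_field_derivative deriv h z) (at z)"
      using h_hol that by (intro holomorphic_derivI[of _ "ball 0 1"]) auto
    then have "deriv (\<lambda>z. of_real k * h z) z = of_real k * deriv h z"
      by (intro DERIV_imp_deriv DERIV_cmult)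
    moreover have "deriv h z \<noteq> 0" using deriv_\<psi>_h[of z] that by auto
    ultimately show ?thesis using k by (simp add: norm_mult)
  qed
  \<comment> \<open>Oddness of \<open>h\<close> gives the identity on the open disc, and continuity
    carries it to the sphere.\<close>
  moreover have "F (- \<zeta>) = - F \<zeta>" if "\<zeta> \<in> sphere 0 1" for \<zeta>
  proof -
    have "continuous_on (closure (ball 0 1)) (\<lambda>z. F (- z) + F z)"
      by (intro continuous_intros continuous_on_compose2[OF cF] cF) auto
    moreover have "F (- z) + F z = 0" if "z \<in> ball 0 1" for z
      using that F(2)[of z] F(2)[of "- z"] h_odd[of z] by (simp add: stretch_linear_simps)
    ultimately have "F (- \<zeta>) + F \<zeta> = 0"
      by (rule continuous_constant_on_closure) (use that in auto)
    then show ?thesis by (simp add: eq_neg_iff_add_eq_0)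
  qed
  ultimately show ?thesis
    unfolding odd_admissible_def using F h_hol h_zero
    by (intro conjI exI[of _ F] exI[of _ F']) (auto simp: harm_eq intro!: holomorphic_intros)
qed

end

text \<open>For \<open>g = k h\<close> the sum is
  \<open>(1 + k\<^sup>2) * (norm (deriv h 0))\<^sup>2\<close>; inserting
  \<open>norm_deriv_h_zero_le\<close> gives a bound that tends to \<open>8 / pi\<^sup>2\<close> as
  \<open>k\<close> tends to 1 from the left.\<close>

lemma exists_odd_admissible_near_bound:
  assumes \<epsilon>: "\<epsilon> > 0"
  shows "\<exists>h g. odd_admissible h g \<and> (norm (deriv h 0))\<^sup>2 + (norm (deriv g 0))\<^sup>2 < 8 / pi\<^sup>2 + \<epsilon>"
proof -
  have "((\<lambda>k. (1 + k\<^sup>2) * (4 / (pi * (1 + k)))\<^sup>2) \<longlongrightarrow> (1 + 1\<^sup>2) * (4 / (pi * (1 + 1)))\<^sup>2) (at_left (1::real))"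
    by (intro tendsto_intros) auto
  moreover have "(1 + 1\<^sup>2) * (4 / (pi * (1 + 1)))\<^sup>2 = 8 / pi\<^sup>2" by (simp add: power_divide power_mult_distrib)
  ultimately have "\<forall>\<^sub>F k in at_left (1::real). (1 + k\<^sup>2) * (4 / (pi * (1 + k)))\<^sup>2 < 8 / pi\<^sup>2 + \<epsilon>"
    using \<epsilon> by (auto intro: order_tendstoD(2))
  moreover have "\<forall>\<^sub>F k in at_left (1::real). k \<in> {0<..<1}"
    by (rule eventually_at_left_real) simp
  ultimately have "\<forall>\<^sub>F k in at_left (1::real). k \<in> {0<..<1} \<and> (1 + k\<^sup>2) * (4 / (pi * (1 + k)))\<^sup>2 < 8 / pi\<^sup>2 + \<epsilon>"
    by (rule eventually_conj[rotated])
  then obtain k :: real where k: "0 < k" "k < 1" "(1 + k\<^sup>2) * (4 / (pi * (1 + k)))\<^sup>2 < 8 / pi\<^sup>2 + \<epsilon>"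
    using eventually_happens'[OF trivial_limit_at_left_real] by (metis (no_types, lifting) greaterThanLessThan_iff)
  note k_near = k(3)
  obtain h \<psi> where "h holomorphic_on ball 0 1" "\<psi> holomorphic_on ellipse k" "h 0 = 0"
    "\<And>z. z \<in> ball 0 1 \<Longrightarrow> h z \<in> ellipse k \<and> \<psi> (h z) = z"
    "\<And>w. w \<in> ellipse k \<Longrightarrow> \<psi> w \<in> ball 0 1 \<and> h (\<psi> w) = w"
    using ellipse_riemann_map[OF k(1,2)] by metis
  then interpret ellipse_map k h \<psi> using k by unfold_locales auto
  have "(h has_field_derivative deriv h 0) (at 0)"
    using h_hol by (intro holomorphic_derivI[of _ "ball 0 1"]) auto
  then have "deriv (\<lambda>z. of_real k * h z) 0 = of_real k * deriv h 0"
    by (intro DERIV_imp_deriv DERIV_cmult)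
  then have "(norm (deriv h 0))\<^sup>2 + (norm (deriv (\<lambda>z. of_real k * h z) 0))\<^sup>2 = (1 + k\<^sup>2) * (norm (deriv h 0))\<^sup>2"
    by (simp add: norm_mult power_mult_distrib algebra_simps)
  also have "\<dots> \<le> (1 + k\<^sup>2) * (4 / (pi * (1 + k)))\<^sup>2"
    by (intro mult_left_mono power_mono norm_deriv_h_zero_le) auto
  finally show ?thesis using k_near odd_admissible by fastforce
qed

theorem theoremA2:
  shows "(\<forall>h g. odd_admissible h g \<longrightarrow>
            (norm (deriv h 0))\<^sup>2 + (norm (deriv g 0))\<^sup>2 \<ge> 8 / pi\<^sup>2)
       \<and> (\<forall>\<epsilon>>0. \<exists>h g. odd_admissible h g \<and>
            (norm (deriv h 0))\<^sup>2 + (norm (deriv g 0))\<^sup>2 < 8 / pi\<^sup>2 + \<epsilon>)"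
  using odd_admissible_lower_bound exists_odd_admissible_near_bound by blast

end
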